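(* Let $d\ge 1$ be an integer and $P\in L^\infty(\mathbf{R}^d;\mathbf{R})$, and let $S(t)=e^{itP(D)}$, $t\in\mathbf{R}$. Suppose that there exist an admissible pair $(p,q)$, an index $k\in\mathbf{R}$, a time interval $I\ni 0$ with $|I|>0$, and a constant $C>0$ such that $$\|S(\cdot)u_0\|_{L^p(I;L^q(\mathbf{R}^d))}\le C\|u_0\|_{H^k(\mathbf{R}^d)}\qquad\text{for all }u_0\in H^k(\mathbf{R}^d).$$ Then necessarily $k\ge \frac 2p=\frac d2-\frac dq$.
   Context: A pair $(p,q)\neq(2,\infty)$ is called admissible if $p\ge 2$, $q\ge 2$ (infinite values being allowed) and $\frac2p=d\left(\frac12-\frac1q\right)$. $D=-i\nabla_x$, and $S(t)=e^{itP(D)}$ is the Fourier multiplier with symbol $e^{itP(\xi)}$, i.e. the unitary group solving $i\partial_tu+P(D)u=0$. $H^k(\mathbf{R}^d)$ is the usual inhomogeneous $L^2$-based Sobolev space. *)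

theory Defs
  imports "HOL-Analysis.Analysis" "HOL-Probability.Essential_Supremum"
begin

section \<open>Lebesgue norms with values in the extended half-line\<close>

definition enn_powr :: "ennreal \<Rightarrow> real \<Rightarrow> ennreal" where
  "enn_powr a r = (if a = top then top else ennreal (enn2real a powr r))"

text \<open>
  The integrand is the pointwise norm of the function, so that the same definition serves for
  the spatial norm and for the temporal norm of \<open>t \<mapsto> \<parallel>S(t)u\<parallel>\<close>, which may be infinite for some \<open>t\<close>.
\<close>

definition Lp_enorm :: "'a measure \<Rightarrow> ereal \<Rightarrow> ('a \<Rightarrow> ennreal) \<Rightarrow> ennreal" where
  "Lp_enorm M p f =
     (if p = \<infinity> then esssup M f
      else enn_powr (\<integral>\<^sup>+x. enn_powr (f x) (real_of_ereal p) \<partial>M) (1 / real_of_ereal p))"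

section \<open>Schwartz functions and tempered distributions\<close>

fun iter_deriv :: "'a::euclidean_space list \<Rightarrow> ('a \<Rightarrow> complex) \<Rightarrow> 'a \<Rightarrow> complex" where
  "iter_deriv [] f = f"
| "iter_deriv (v # vs) f = (\<lambda>x. frechet_derivative (iter_deriv vs f) (at x) v)"

text \<open>
  A list of basis vectors plays the role of a multi-index, its length being the order.
  Differentiability of all iterated partial derivatives is smoothness.
\<close>

definition schwartz :: "('a::euclidean_space \<Rightarrow> complex) set" where
  "schwartz = {f. \<forall>vs. set vs \<subseteq> Basis \<longrightarrow>
     (\<forall>x. iter_deriv vs f differentiable (at x)) \<and>
     (\<forall>N::nat. bounded (range (\<lambda>x. (1 + norm x) ^ N *\<^sub>R iter_deriv vs f x)))}"

definition schwartz_seminorm :: "nat \<Rightarrow> ('a::euclidean_space \<Rightarrow> complex) \<Rightarrow> real" where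
  "schwartz_seminorm N f =
     (SUP (vs, x) \<in> {vs. set vs \<subseteq> Basis \<and> length vs \<le> N} \<times> UNIV.
        (1 + norm x) ^ N * norm (iter_deriv vs f x))"

text \<open>
  A distribution is represented by a functional on all functions, of which only the values on
  Schwartz functions are meaningful; no definition below depends on the other values.
\<close>

definition tempered_distribution :: "(('a::euclidean_space \<Rightarrow> complex) \<Rightarrow> complex) \<Rightarrow> bool" where
  "tempered_distribution u \<longleftrightarrow>
     (\<forall>f\<in>schwartz. \<forall>g\<in>schwartz. u (\<lambda>x. f x + g x) = u f + u g) \<and>
     (\<forall>c. \<forall>f\<in>schwartz. u (\<lambda>x. c * f x) = c * u f) \<and>
     (\<exists>N C. \<forall>f\<in>schwartz. norm (u f) \<le> C * schwartz_seminorm N f)"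

definition dist_of_fun :: "('a::euclidean_space \<Rightarrow> complex) \<Rightarrow> ('a \<Rightarrow> complex) \<Rightarrow> complex" where
  "dist_of_fun g = (\<lambda>\<phi>. \<integral>x. g x * \<phi> x \<partial>lebesgue)"

definition represents ::
  "('a::euclidean_space \<Rightarrow> complex) \<Rightarrow> (('a \<Rightarrow> complex) \<Rightarrow> complex) \<Rightarrow> bool" where
  "represents g u \<longleftrightarrow> g \<in> borel_measurable lebesgue \<and>
     (\<forall>\<phi>\<in>schwartz. integrable lebesgue (\<lambda>x. g x * \<phi> x) \<and> u \<phi> = dist_of_fun g \<phi>)"

text \<open>
  The \<open>L\<^sup>q\<close> norm of a distribution, equal to \<open>\<infinity>\<close> if no function represents it. Representing
  functions agree almost everywhere, so the infimum is over at most one value.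
\<close>

definition dist_Lq_norm ::
  "ereal \<Rightarrow> (('a::euclidean_space \<Rightarrow> complex) \<Rightarrow> complex) \<Rightarrow> ennreal" where
  "dist_Lq_norm q u =
     (INF g\<in>{g. represents g u}. Lp_enorm lebesgue q (\<lambda>x. ennreal (norm (g x))))"

section \<open>Fourier transform, Sobolev spaces and Fourier multipliers\<close>

text \<open>Unitary normalisation, for which \<open>-\<i>\<nabla>\<close> is the multiplier with symbol \<open>\<xi>\<close>.\<close>

definition fourier :: "('a::euclidean_space \<Rightarrow> complex) \<Rightarrow> 'a \<Rightarrow> complex" where
  "fourier f \<xi> = of_real ((2 * pi) powr (- real DIM('a) / 2)) *
     (\<integral>x. exp (- (\<i> * of_real (x \<bullet> \<xi>))) * f x \<partial>lebesgue)"

definition inv_fourier :: "('a::euclidean_space \<Rightarrow> complex) \<Rightarrow> 'a \<Rightarrow> complex" where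
  "inv_fourier f x = of_real ((2 * pi) powr (- real DIM('a) / 2)) *
     (\<integral>\<xi>. exp (\<i> * of_real (x \<bullet> \<xi>)) * f \<xi> \<partial>lebesgue)"

definition dist_fourier ::
  "(('a::euclidean_space \<Rightarrow> complex) \<Rightarrow> complex) \<Rightarrow> ('a \<Rightarrow> complex) \<Rightarrow> complex" where
  "dist_fourier u = (\<lambda>\<phi>. u (fourier \<phi>))"

definition dist_inv_fourier ::
  "(('a::euclidean_space \<Rightarrow> complex) \<Rightarrow> complex) \<Rightarrow> ('a \<Rightarrow> complex) \<Rightarrow> complex" where
  "dist_inv_fourier u = (\<lambda>\<phi>. u (inv_fourier \<phi>))"

text \<open>For distributions whose Fourier transform is a function; it is unique almost everywhere.\<close>

definition fourier_fun ::
  "(('a::euclidean_space \<Rightarrow> complex) \<Rightarrow> complex) \<Rightarrow> 'a \<Rightarrow> complex" where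
  "fourier_fun u = (SOME g. represents g (dist_fourier u))"

definition sobolev_norm ::
  "real \<Rightarrow> (('a::euclidean_space \<Rightarrow> complex) \<Rightarrow> complex) \<Rightarrow> ennreal" where
  "sobolev_norm k u = Lp_enorm lebesgue 2
     (\<lambda>\<xi>. ennreal ((1 + (norm \<xi>)\<^sup>2) powr (k / 2) * norm (fourier_fun u \<xi>)))"

definition sobolev :: "real \<Rightarrow> (('a::euclidean_space \<Rightarrow> complex) \<Rightarrow> complex) set" where
  "sobolev k = {u. tempered_distribution u \<and>
     (\<exists>g. represents g (dist_fourier u)) \<and> sobolev_norm k u < \<infinity>}"

definition fourier_multiplier ::
  "('a::euclidean_space \<Rightarrow> complex) \<Rightarrow>
   (('a \<Rightarrow> complex) \<Rightarrow> complex) \<Rightarrow> ('a \<Rightarrow> complex) \<Rightarrow> complex" where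
  "fourier_multiplier m u = dist_inv_fourier (dist_of_fun (\<lambda>\<xi>. m \<xi> * fourier_fun u \<xi>))"

definition propagator ::
  "('a::euclidean_space \<Rightarrow> real) \<Rightarrow> real \<Rightarrow>
   (('a \<Rightarrow> complex) \<Rightarrow> complex) \<Rightarrow> ('a \<Rightarrow> complex) \<Rightarrow> complex" where
  "propagator P t = fourier_multiplier (\<lambda>\<xi>. exp (\<i> * of_real (t * P \<xi>)))"

section \<open>Admissible pairs\<close>

text \<open>In \<^typ>\<open>ereal\<close>, \<open>2 / \<infinity> = 1 / \<infinity> = 0\<close>.\<close>

definition admissible :: "nat \<Rightarrow> ereal \<Rightarrow> ereal \<Rightarrow> bool" where
  "admissible d p q \<longleftrightarrow> 2 \<le> p \<and> 2 \<le> q \<and> (p, q) \<noteq> (2, \<infinity>) \<and>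
     2 / p = ereal (real d) * (1 / 2 - 1 / q)"

end

theory Submission
  imports Defs "HOL-Probability.Characteristic_Functions" "HOL-Probability.Sinc_Integral"
    "HOL-Real_Asymp.Real_Asymp"
begin

text \<open>
  A bounded symbol moves phases by at most \<open>\<bar>t\<bar> \<parallel>P\<parallel>\<^sub>\<infinity>\<close>, so for small times, uniformly in the data, the flow
  stays close to the identity and cannot improve integrability. Take Gaussian data
  \<open>exp (- r\<^sup>2 \<bar>x\<bar>\<^sup>2 / 2)\<close> with \<open>r \<rightarrow> \<infinity>\<close>. Pairing the solution with the datum itself shows that its
  \<open>L\<^sup>q\<close> norm is at least a constant times \<open>r powr (- d / q)\<close> on a fixed time interval around \<open>0\<close>,
  whereas the square of the \<open>H\<^sup>k\<close> norm of the datum is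
  \<open>r powr (- d)\<close> times the integral of \<open>(1 + r\<^sup>2 \<bar>\<eta>\<bar>\<^sup>2) powr k * exp (- \<bar>\<eta>\<bar>\<^sup>2)\<close>. By dominated
  convergence that integral is \<open>o (r powr (2 s))\<close> for every \<open>s > k\<close> with \<open>s \<ge> 0\<close>;
  for \<open>k < 2 / p\<close> the choice \<open>s = 2 / p = d / 2 - d / q\<close> contradicts the estimate.
\<close>

section \<open>Gaussians times polynomials as Schwartz functions\<close>

lemma real_polynomial_function_bound:
  fixes p :: "'a::real_normed_vector \<Rightarrow> real"
  assumes "real_polynomial_function p"
  shows "\<exists>C N. 0 \<le> C \<and> (\<forall>x. \<bar>p x\<bar> \<le> C * (1 + norm x) ^ N)"
  using assms
proof induction
  case (linear f)
  then obtain K where K: "K > 0" "\<And>x. norm (f x) \<le> norm x * K"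
    using bounded_linear.pos_bounded by blast
  have "\<bar>f x\<bar> \<le> K * (1 + norm x) ^ 1" for x
    using K(2)[of x] K(1) by (simp add: algebra_simps)
  then show ?case using K(1) by (meson less_imp_le)
next
  case (const c)
  have "\<bar>c\<bar> \<le> \<bar>c\<bar> * (1 + norm x) ^ 0" for x :: 'a
    by simp
  then show ?case by (meson abs_ge_zero)
next
  case (add f g)
  then obtain C N C' N' where b: "0 \<le> C" "0 \<le> C'" "\<And>x. \<bar>f x\<bar> \<le> C * (1 + norm x) ^ N"
    "\<And>x. \<bar>g x\<bar> \<le> C' * (1 + norm x) ^ N'"
    by metis
  have "\<bar>f x + g x\<bar> \<le> (C + C') * (1 + norm x) ^ (N + N')" for x
  proof -
    have "C * (1 + norm x) ^ N \<le> C * (1 + norm x) ^ (N + N')"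
      "C' * (1 + norm x) ^ N' \<le> C' * (1 + norm x) ^ (N + N')"
      using b by (intro mult_left_mono power_increasing; simp)+
    then show ?thesis using b(3)[of x] b(4)[of x] by (simp add: algebra_simps)
  qed
  then show ?case using b(1,2) by (meson add_nonneg_nonneg)
next
  case (mult f g)
  then obtain C N C' N' where b: "0 \<le> C" "0 \<le> C'" "\<And>x. \<bar>f x\<bar> \<le> C * (1 + norm x) ^ N"
    "\<And>x. \<bar>g x\<bar> \<le> C' * (1 + norm x) ^ N'"
    by metis
  have "\<bar>f x * g x\<bar> \<le> (C * C') * (1 + norm x) ^ (N + N')" for x
  proof -
    have "\<bar>f x\<bar> * \<bar>g x\<bar> \<le> (C * (1 + norm x) ^ N) * (C' * (1 + norm x) ^ N')"
      by (intro mult_mono b) (use b in auto)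
    then show ?thesis by (simp add: abs_mult power_add mult_ac)
  qed
  then show ?case using b(1,2) by (meson mult_nonneg_nonneg)
qed

text \<open>Directional derivatives stay inside the polynomial class, which is what lets the
  induction along \<open>iter_deriv\<close> close. The total derivative \<open>D\<close> is
  supplied, since \<open>iter_deriv\<close> is built from Frechet derivatives.\<close>

lemma real_polynomial_function_has_derivative:
  fixes p :: "'a::real_normed_vector \<Rightarrow> real"
  assumes "real_polynomial_function p"
  shows "\<exists>D. (\<forall>x. (p has_derivative D x) (at x)) \<and> (\<forall>v. real_polynomial_function (\<lambda>x. D x v))"
  using assms
proof induction
  case (linear f)
  then show ?case
    by (intro exI[of _ "\<lambda>x. f"]) (auto intro: bounded_linear_imp_has_derivative)
next
  case (const c)
  show ?case by (intro exI[of _ "\<lambda>x v. 0"]) auto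
next
  case (add f g)
  then obtain D D' where D: "\<And>x. (f has_derivative D x) (at x)" "\<And>x. (g has_derivative D' x) (at x)"
    "\<And>v. real_polynomial_function (\<lambda>x. D x v)" "\<And>v. real_polynomial_function (\<lambda>x. D' x v)"
    by metis
  show ?case
    by (intro exI[of _ "\<lambda>x v. D x v + D' x v"])
      (intro conjI allI D has_derivative_add real_polynomial_function.intros(3))
next
  case (mult f g)
  then obtain D D' where D: "\<And>x. (f has_derivative D x) (at x)" "\<And>x. (g has_derivative D' x) (at x)"
    "\<And>v. real_polynomial_function (\<lambda>x. D x v)" "\<And>v. real_polynomial_function (\<lambda>x. D' x v)"
    by metis
  show ?case
    by (intro exI[of _ "\<lambda>x v. f x * D' x v + D x v * g x"])
      (intro conjI allI D has_derivative_mult real_polynomial_function.intros(3,4) mult.hyps)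
qed

lemma polynomial_gaussian_bounded:
  fixes a :: real
  assumes "0 < a"
  shows "\<exists>C. \<forall>x::'a::real_normed_vector. (1 + norm x) ^ N * exp (- a * (norm x)\<^sup>2) \<le> C"
proof -
  have "((\<lambda>r. (1 + r) ^ N * exp (- a * r\<^sup>2)) \<longlongrightarrow> 0) at_top"
    using assms by real_asymp
  then have "eventually (\<lambda>r. (1 + r) ^ N * exp (- a * r\<^sup>2) < 1) at_top"
    by (rule order_tendstoD) simp
  then obtain r0 where r0: "\<And>r. r \<ge> r0 \<Longrightarrow> (1 + r) ^ N * exp (- a * r\<^sup>2) < 1"
    by (auto simp: eventually_at_top_linorder)
  have "(1 + norm x) ^ N * exp (- a * (norm x)\<^sup>2) \<le> max 1 ((1 + max r0 0) ^ N)" for x :: 'a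
  proof (cases "norm x \<ge> r0")
    case True
    then show ?thesis
      by (intro order_trans[OF less_imp_le[OF r0[OF True]]] max.cobounded1)
  next
    case False
    have "(1 + norm x) ^ N * exp (- a * (norm x)\<^sup>2) \<le> (1 + max r0 0) ^ N * 1"
      using False assms by (intro mult_mono power_mono) auto
    then show ?thesis by auto
  qed
  then show ?thesis by blast
qed

text \<open>Polynomials times one fixed Gaussian are closed under differentiation: the rate
  \<open>a\<close> never changes, so the induction over \<open>vs\<close> only has to track the
  polynomial factor.\<close>

lemma iter_deriv_polynomial_gaussian:
  fixes p :: "'a::euclidean_space \<Rightarrow> real" and a :: real
  assumes "real_polynomial_function p"
  shows "\<exists>q. real_polynomial_function q \<and>
    iter_deriv vs (\<lambda>x. complex_of_real (p x * exp (- a * (norm x)\<^sup>2))) =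
      (\<lambda>x. complex_of_real (q x * exp (- a * (norm x)\<^sup>2))) \<and>
    (\<forall>x. iter_deriv vs (\<lambda>x. complex_of_real (p x * exp (- a * (norm x)\<^sup>2))) differentiable (at x))"
proof (induction vs)
  have der: "\<exists>D. (\<forall>v. real_polynomial_function (\<lambda>x. D x v)) \<and>
    (\<forall>x. ((\<lambda>x. complex_of_real (q x * exp (- a * (norm x)\<^sup>2))) has_derivative
      (\<lambda>v. complex_of_real (D x v * exp (- a * (norm x)\<^sup>2)))) (at x))"
    if q: "real_polynomial_function q" for q :: "'a \<Rightarrow> real"
  proof -
    obtain D where D: "\<And>x. (q has_derivative D x) (at x)" "\<And>v. real_polynomial_function (\<lambda>x. D x v)"
      using real_polynomial_function_has_derivative[OF q] by metis
    \<comment> \<open>Product rule: the Gaussian differentiates in direction \<open>v\<close> to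
      itself times \<open>- 2 * a * (x \<bullet> v)\<close>, which is linear in \<open>x\<close> and
      so keeps the factor polynomial.\<close>
    define E where "E = (\<lambda>x v. D x v + q x * (- 2 * a * (x \<bullet> v)))"
    have "((\<lambda>x. complex_of_real (q x * exp (- a * (x \<bullet> x)))) has_derivative
      (\<lambda>v. complex_of_real (E x v * exp (- a * (x \<bullet> x))))) (at x)" for x
      unfolding E_def
      by (auto intro!: derivative_eq_intros D(1) ext simp: algebra_simps inner_commute)
    moreover have "real_polynomial_function (\<lambda>x. E x v)" for v
      unfolding E_def
      by (rule real_polynomial_function.intros(3)[OF D(2)
            real_polynomial_function.intros(4)[OF q real_polynomial_function.intros(1)]])
        (intro bounded_linear_const_mult bounded_linear_inner_left)
    ultimately show ?thesis unfolding power2_norm_eq_inner by (intro exI[of _ E] conjI allI)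
  qed
  {
    case Nil
    show ?case
      unfolding iter_deriv.simps differentiable_def
      by (intro exI[of _ p] conjI assms refl allI) (use der[OF assms] in meson)
  next
    case (Cons v vs)
    then obtain q where q: "real_polynomial_function q" and
      eq: "iter_deriv vs (\<lambda>x. complex_of_real (p x * exp (- a * (norm x)\<^sup>2))) =
        (\<lambda>x. complex_of_real (q x * exp (- a * (norm x)\<^sup>2)))" by meson
    obtain D where "\<forall>v. real_polynomial_function (\<lambda>x. D x v)" and
      "\<forall>x. ((\<lambda>x. complex_of_real (q x * exp (- a * (norm x)\<^sup>2))) has_derivative
        (\<lambda>v. complex_of_real (D x v * exp (- a * (norm x)\<^sup>2)))) (at x)"
      using der[OF q] by (elim exE conjE)
    note D = this[rule_format]
    have eq': "iter_deriv (v # vs) (\<lambda>x. complex_of_real (p x * exp (- a * (norm x)\<^sup>2))) =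
        (\<lambda>x. complex_of_real (D x v * exp (- a * (norm x)\<^sup>2)))"
      by (simp only: iter_deriv.simps eq frechet_derivative_at[OF D(2), symmetric])
    show ?case
      unfolding eq' differentiable_def
      by (intro exI[of _ "\<lambda>x. D x v"] conjI D(1) refl allI) (use der[OF D(1)[of v]] in meson)
  }
qed

text \<open>The polynomial in front of each derivative is dominated by a power of
  \<open>1 + norm x\<close>; together with the weight of the seminorm this is one larger power,
  still beaten by the Gaussian.\<close>

lemma polynomial_gaussian_schwartz:
  fixes p :: "'a::euclidean_space \<Rightarrow> real"
  assumes "real_polynomial_function p" "0 < a"
  shows "(\<lambda>x. complex_of_real (p x * exp (- a * (norm x)\<^sup>2))) \<in> schwartz"
  unfolding schwartz_def
proof (intro CollectI allI impI conjI)
  fix vs :: "'a list" and N :: nat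
  obtain q where q: "real_polynomial_function q" and
    eq: "iter_deriv vs (\<lambda>x. complex_of_real (p x * exp (- a * (norm x)\<^sup>2))) =
      (\<lambda>x. complex_of_real (q x * exp (- a * (norm x)\<^sup>2)))"
    using iter_deriv_polynomial_gaussian[OF assms(1), of vs a] by meson
  obtain C m where C: "0 \<le> C" "\<And>x. \<bar>q x\<bar> \<le> C * (1 + norm x) ^ m"
    using real_polynomial_function_bound[OF q] by metis
  obtain B where B: "\<And>x::'a. (1 + norm x) ^ (N + m) * exp (- a * (norm x)\<^sup>2) \<le> B"
    using polynomial_gaussian_bounded[OF assms(2)] by metis
  have "norm ((1 + norm x) ^ N *\<^sub>R complex_of_real (q x * exp (- a * (norm x)\<^sup>2))) \<le> C * B" for x
  proof -
    have "norm ((1 + norm x) ^ N *\<^sub>R complex_of_real (q x * exp (- a * (norm x)\<^sup>2))) =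
      \<bar>q x\<bar> * ((1 + norm x) ^ N * exp (- a * (norm x)\<^sup>2))"
      by (simp add: norm_mult)
    also have "\<dots> \<le> (C * (1 + norm x) ^ m) * ((1 + norm x) ^ N * exp (- a * (norm x)\<^sup>2))"
      by (intro mult_right_mono C) auto
    also have "\<dots> = C * ((1 + norm x) ^ (N + m) * exp (- a * (norm x)\<^sup>2))"
      by (simp add: power_add)
    also have "\<dots> \<le> C * B" by (intro mult_left_mono B C)
    finally show ?thesis .
  qed
  then show "bounded (range (\<lambda>x. (1 + norm x) ^ N *\<^sub>R
      iter_deriv vs (\<lambda>x. complex_of_real (p x * exp (- a * (norm x)\<^sup>2))) x))"
    unfolding eq bounded_iff by auto
qed (use iter_deriv_polynomial_gaussian[OF assms(1), of _ a] in meson)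

section \<open>Continuity, decay and boundedness of Schwartz functions\<close>

lemma schwartz_continuous:
  assumes "f \<in> schwartz"
  shows "continuous_on UNIV f"
proof -
  have "\<forall>x. f differentiable (at x)"
    using assms[unfolded schwartz_def mem_Collect_eq, rule_format, of "[]"] by auto
  then show ?thesis
    by (auto intro!: continuous_at_imp_continuous_on differentiable_imp_continuous_within)
qed

lemma schwartz_borel_measurable:
  "f \<in> schwartz \<Longrightarrow> f \<in> borel_measurable borel"
  using schwartz_continuous by (rule borel_measurable_continuous_onI)

lemma schwartz_decay:
  assumes "f \<in> schwartz"
  obtains C where "\<And>x. (1 + norm x) ^ N * norm (f x) \<le> C"
proof -
  have "bounded (range (\<lambda>x. (1 + norm x) ^ N *\<^sub>R f x))"
    using assms[unfolded schwartz_def mem_Collect_eq, rule_format, of "[]"] by auto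
  then show ?thesis using that unfolding bounded_iff by auto
qed

lemma norm_le_schwartz_seminorm:
  assumes "f \<in> schwartz"
  shows "norm (f x) \<le> schwartz_seminorm 0 f"
proof -
  obtain C where "\<And>x. norm (f x) \<le> C"
    using schwartz_decay[OF assms, of 0] by auto
  then have "bdd_above ((\<lambda>(vs, x). (1 + norm x) ^ 0 * norm (iter_deriv vs f x)) `
      ({vs. set vs \<subseteq> Basis \<and> length vs \<le> 0} \<times> UNIV))"
    by (intro bdd_aboveI[of _ C]) auto
  then show ?thesis
    unfolding schwartz_seminorm_def by (intro cSUP_upper2[of _ _ "([], x)"]) auto
qed

section \<open>Uniqueness of representing functions\<close>

text \<open>Up to a null set, the set where \<open>f\<close> is positive is a countable union of
  compact sets. On each of them a positive function has integral zero, so each is null.\<close>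

lemma AE_nonpos_if_compact_integrals_zero:
  fixes f :: "'a::euclidean_space \<Rightarrow> real"
  assumes f: "integrable lebesgue f"
    and zero: "\<And>S. compact S \<Longrightarrow> (\<integral>x. f x * indicator S x \<partial>lebesgue) = 0"
  shows "AE x in lebesgue. f x \<le> 0"
proof -
  have [measurable]: "f \<in> borel_measurable lebesgue" using f by auto
  have "{x \<in> space lebesgue. 0 < f x} \<in> sets lebesgue" by measurable
  then obtain S T where S: "fsigma S" "T \<in> null_sets lebesgue" "S \<union> T = {x \<in> space lebesgue. 0 < f x}"
    using lebesgue_set_almost_fsigma by metis
  obtain K :: "nat \<Rightarrow> 'a set" where K: "\<And>n. compact (K n)" "S = (\<Union>n. K n)"
    using S(1) unfolding fsigma_Union_compact by (metis image_subset_iff mem_Collect_eq UNIV_I)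
  have "K n \<in> null_sets lebesgue" for n
  proof -
    have [measurable]: "K n \<in> sets lebesgue" using K(1) by (simp add: lmeasurable_compact fmeasurableD)
    have pos: "0 < f x" if "x \<in> K n" for x using that S(3) K(2) by auto
    have int: "integrable lebesgue (\<lambda>x. f x * indicator (K n) x)"
      using integrable_mult_indicator[OF \<open>K n \<in> sets lebesgue\<close> f] by (simp add: mult.commute)
    have "AE x in lebesgue. f x * indicator (K n) x = 0"
      using zero[OF K(1)] integral_nonneg_eq_0_iff_AE[OF int] pos
      by (auto simp: indicator_def less_imp_le)
    then have "AE x in lebesgue. x \<notin> K n"
      by eventually_elim (use pos in \<open>force simp: indicator_def split: if_splits\<close>)
    then show ?thesis using AE_iff_null_sets[OF \<open>K n \<in> sets lebesgue\<close>] by blast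
  qed
  then have "S \<union> T \<in> null_sets lebesgue" unfolding K(2) using S(2) by auto
  then have "AE x in lebesgue. x \<notin> S \<union> T" by (rule AE_not_in)
  then show ?thesis by eventually_elim (use S(3) in auto)
qed

lemma AE_zero_if_compact_integrals_zero:
  fixes f :: "'a::euclidean_space \<Rightarrow> complex"
  assumes f: "integrable lebesgue f"
    and zero: "\<And>S. compact S \<Longrightarrow> (\<integral>x. f x * indicator S x \<partial>lebesgue) = 0"
  shows "AE x in lebesgue. f x = 0"
proof -
  have int: "integrable lebesgue (\<lambda>x. f x * indicator S x)" if "compact S" for S
  proof -
    have "S \<in> sets lebesgue" using that by (simp add: lmeasurable_compact fmeasurableD)
    from integrable_mult_indicator[OF this f] show ?thesis
      by (simp add: scaleR_conv_of_real of_real_indicator mult.commute)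
  qed
  have [simp]: "Re (indicator S x) = indicator S x" "Im (indicator S x) = 0" for S and x :: 'a
    by (auto simp: indicator_def)
  have re: "(\<integral>x. Re (f x) * indicator S x \<partial>lebesgue) = 0" if "compact S" for S
    using integral_Re[OF int[OF that]] zero[OF that] by simp
  have im: "(\<integral>x. Im (f x) * indicator S x \<partial>lebesgue) = 0" if "compact S" for S
    using integral_Im[OF int[OF that]] zero[OF that] by simp
  have "AE x in lebesgue. Re (f x) \<le> 0" "AE x in lebesgue. - Re (f x) \<le> 0"
    "AE x in lebesgue. Im (f x) \<le> 0" "AE x in lebesgue. - Im (f x) \<le> 0"
    by (rule AE_nonpos_if_compact_integrals_zero; use f re im in simp)+
  then show ?thesis by eventually_elim (auto simp: complex_eq_iff)
qed

section \<open>An algebra of Gaussian sums and its density\<close>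

inductive polynomial_gaussian_sum :: "('a::real_normed_vector \<Rightarrow> real) \<Rightarrow> bool" where
  single: "real_polynomial_function q \<Longrightarrow>
    polynomial_gaussian_sum (\<lambda>x. q x * exp (- real n * (norm x)\<^sup>2))"
| add: "polynomial_gaussian_sum f \<Longrightarrow> polynomial_gaussian_sum g \<Longrightarrow>
    polynomial_gaussian_sum (\<lambda>x. f x + g x)"

lemma polynomial_gaussian_sum_mult:
  assumes "polynomial_gaussian_sum f" "polynomial_gaussian_sum g"
  shows "polynomial_gaussian_sum (\<lambda>x. f x * g x)"
  using assms(1)
proof induction
  case f: (single p m)
  show ?case
    using assms(2)
  proof induction
    case (single q n)
    have "polynomial_gaussian_sum (\<lambda>x. (p x * q x) * exp (- real (m + n) * (norm x)\<^sup>2))"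
      by (rule polynomial_gaussian_sum.single[OF real_polynomial_function.intros(4)[OF f single]])
    then show ?case
      by (simp add: exp_add[symmetric] algebra_simps flip: exp_add)
  next
    case (add g h)
    then show ?case using polynomial_gaussian_sum.add[OF add.IH] by (simp add: algebra_simps)
  qed
next
  case (add f h)
  then show ?case using polynomial_gaussian_sum.add[OF add.IH] by (simp add: algebra_simps)
qed

text \<open>
  Injective with bounded range, so that by Stone--Weierstrass polynomials in it approximate every
  continuous function of it uniformly on the whole space.
\<close>

definition gaussian_embedding :: "'a::real_normed_vector \<Rightarrow> real \<times> 'a" where
  "gaussian_embedding x = (exp (- (norm x)\<^sup>2), exp (- (norm x)\<^sup>2) *\<^sub>R x)"

text \<open>The class is an algebra containing the constants, so only linear \<open>f\<close> need
  work. There homogeneity pulls out the common factor \<open>exp (- (norm x)\<^sup>2)\<close>,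
  leaving the affine function \<open>f (1, 0) + f (0, x)\<close>, that is, a single term of rate
  \<open>1\<close>.\<close>

lemma polynomial_gaussian_sum_embedding:
  fixes p :: "real \<times> 'a::real_normed_vector \<Rightarrow> real"
  assumes "real_polynomial_function p"
  shows "polynomial_gaussian_sum (\<lambda>x. p (gaussian_embedding x))"
  using assms
proof induction
  case (linear f)
  note lin = linear
  interpret bounded_linear f by (rule lin)
  have "real_polynomial_function (\<lambda>x. f (1, 0) + f (0, x))"
    by (intro real_polynomial_function.intros(3) real_polynomial_function.intros(2)
        real_polynomial_function.intros(1) bounded_linear_compose[OF lin]
        bounded_linear_Pair bounded_linear_zero bounded_linear_ident)
  from polynomial_gaussian_sum.single[OF this, of 1]
  have "polynomial_gaussian_sum (\<lambda>x. (f (1, 0) + f (0, x)) * exp (- (norm x)\<^sup>2))"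
    by simp
  moreover have "f (gaussian_embedding x) = (f (1, 0) + f (0, x)) * exp (- (norm x)\<^sup>2)" for x
  proof -
    have "gaussian_embedding x = exp (- (norm x)\<^sup>2) *\<^sub>R ((1, 0) + (0, x))"
      by (simp add: gaussian_embedding_def)
    then show ?thesis by (simp only: scaleR add real_scaleR_def) (simp add: mult.commute)
  qed
  ultimately show ?case by simp
next
  case (const c)
  show ?case
    using polynomial_gaussian_sum.single[OF real_polynomial_function.intros(2), of c 0] by simp
qed (auto intro: polynomial_gaussian_sum.add polynomial_gaussian_sum_mult)

text \<open>The first component determines the positive factor by which the second one scales the
  point.\<close>

lemma inj_gaussian_embedding: "inj gaussian_embedding"
  by (rule injI) (auto simp: gaussian_embedding_def)

lemma bounded_range_gaussian_embedding:
  "bounded (range (gaussian_embedding :: 'a::real_normed_vector \<Rightarrow> _))"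
proof -
  obtain C where C: "\<And>x::'a. (1 + norm x) ^ 1 * exp (- 1 * (norm x)\<^sup>2) \<le> C"
    using polynomial_gaussian_bounded[of 1 1] by auto
  have "norm (gaussian_embedding x) \<le> C" for x :: 'a
  proof -
    have "norm (gaussian_embedding x) \<le> exp (- (norm x)\<^sup>2) + exp (- (norm x)\<^sup>2) * norm x"
      unfolding gaussian_embedding_def by (rule order_trans[OF norm_Pair_le]) simp
    then show ?thesis using C[of x] by (simp add: algebra_simps)
  qed
  then show ?thesis unfolding bounded_iff by auto
qed

lemma continuous_on_gaussian_embedding: "continuous_on S gaussian_embedding"
  unfolding gaussian_embedding_def by (intro continuous_intros)

text \<open>After damping \<open>h\<close> by one Gaussian, orthogonality to polynomials times
  Gaussians passes by Stone-Weierstrass to all continuous functions of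
  \<open>gaussian_embedding\<close>, and from these by dominated convergence to indicators of
  compact sets. Thus no construction of compactly supported smooth functions enters.\<close>

lemma AE_zero_if_orthogonal_to_schwartz:
  fixes h :: "'a::euclidean_space \<Rightarrow> complex"
  assumes meas: "h \<in> borel_measurable lebesgue"
    and int: "\<And>\<phi>. \<phi> \<in> schwartz \<Longrightarrow> integrable lebesgue (\<lambda>x. h x * \<phi> x)"
    and zero: "\<And>\<phi>. \<phi> \<in> schwartz \<Longrightarrow> (\<integral>x. h x * \<phi> x \<partial>lebesgue) = 0"
  shows "AE x in lebesgue. h x = 0"
proof -
  let ?e = "gaussian_embedding :: 'a \<Rightarrow> real \<times> 'a"
  \<comment> \<open>The extra Gaussian raises a rate \<open>n\<close> to \<open>n + 1\<close>, which
    is positive even for \<open>n = 0\<close>. Hence every member of the class pairs with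
    \<open>w\<close>, and the constant \<open>1\<close> shows that \<open>w\<close> is
    integrable.\<close>
  define w where "w = (\<lambda>x. h x * complex_of_real (exp (- (norm x)\<^sup>2)))"
  have sum: "integrable lebesgue (\<lambda>x. w x * complex_of_real (f x)) \<and>
      (\<integral>x. w x * complex_of_real (f x) \<partial>lebesgue) = 0" if "polynomial_gaussian_sum f" for f
    using that
  proof induction
    case (single q n)
    have eq: "w x * complex_of_real (q x * exp (- real n * (norm x)\<^sup>2)) =
        h x * complex_of_real (q x * exp (- (real n + 1) * (norm x)\<^sup>2))" for x
      by (simp add: w_def algebra_simps of_real_mult[symmetric] exp_add[symmetric] del: of_real_mult)
    have "(\<lambda>x. complex_of_real (q x * exp (- (real n + 1) * (norm x)\<^sup>2))) \<in> schwartz"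
      by (intro polynomial_gaussian_schwartz single) auto
    from int[OF this] zero[OF this] show ?case unfolding eq by (intro conjI)
  next
    case (add f g)
    then show ?case by (simp add: algebra_simps)
  qed
  have w: "integrable lebesgue w"
    using sum[OF polynomial_gaussian_sum.single[OF real_polynomial_function.intros(2), of 1 0]] by simp
  have [measurable]: "w \<in> borel_measurable lebesgue" using w by auto
  have [measurable]: "?e \<in> borel_measurable lebesgue"
    using continuous_on_gaussian_embedding
    by (intro measurable_completion) (simp, rule borel_measurable_continuous_onI)
  \<comment> \<open>The range is bounded but not closed: the embedding tends to the origin at
    infinity without reaching it. Stone-Weierstrass needs the compact closure.\<close>
  define K where "K = closure (range ?e)"
  have "compact K" unfolding K_def using bounded_range_gaussian_embedding compact_closure by blast
  have K: "?e x \<in> K" for x unfolding K_def using closure_subset[of "range ?e"] by auto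
  have cont: "(\<integral>x. w x * complex_of_real (F (?e x)) \<partial>lebesgue) = 0"
    if F: "continuous_on UNIV F" for F
  proof -
    have bm: "(\<lambda>x. F (?e x)) \<in> borel_measurable lebesgue"
      using borel_measurable_continuous_onI[OF F] by measurable
    have *: "norm (\<integral>x. w x * complex_of_real (F (?e x)) \<partial>lebesgue) \<le> \<epsilon> * (\<integral>x. norm (w x) \<partial>lebesgue)"
      if "\<epsilon> > 0" for \<epsilon>
    proof -
      obtain p where p: "real_polynomial_function p" "\<And>y. y \<in> K \<Longrightarrow> \<bar>F y - p y\<bar> < \<epsilon>"
        using Stone_Weierstrass_real_polynomial_function[OF \<open>compact K\<close> continuous_on_subset[OF F] \<open>\<epsilon> > 0\<close>]
        by auto
      note s = sum[OF polynomial_gaussian_sum_embedding[OF p(1)]]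
      have le: "norm (w x * complex_of_real (F (?e x) - p (?e x))) \<le> norm (\<epsilon> * norm (w x))" for x
      proof -
        have "norm (w x) * \<bar>F (?e x) - p (?e x)\<bar> \<le> norm (w x) * \<epsilon>"
          by (intro mult_left_mono less_imp_le[OF p(2)[OF K]]) auto
        then show ?thesis using \<open>\<epsilon> > 0\<close>
          by (simp only: norm_mult norm_of_real real_norm_def abs_mult abs_norm_cancel mult.commute abs_of_pos)
      qed
      have "(\<lambda>x. p (?e x)) \<in> borel_measurable lebesgue"
        using borel_measurable_continuous_onI[of p] continuous_on_polymonial_function p(1)
        unfolding real_polynomial_function_eq by measurable
      then have "(\<lambda>x. w x * complex_of_real (F (?e x) - p (?e x))) \<in> borel_measurable lebesgue"
        using bm by measurable
      then have d: "integrable lebesgue (\<lambda>x. w x * complex_of_real (F (?e x) - p (?e x)))"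
        by (rule Bochner_Integration.integrable_bound[of _ "\<lambda>x. \<epsilon> * norm (w x)", rotated])
          (intro integrable_mult_right integrable_norm w AE_I2 le)+
      have "(\<integral>x. w x * complex_of_real (F (?e x)) \<partial>lebesgue) =
          (\<integral>x. w x * complex_of_real (F (?e x) - p (?e x)) + w x * complex_of_real (p (?e x)) \<partial>lebesgue)"
        by (intro Bochner_Integration.integral_cong) (auto simp: algebra_simps)
      also have "\<dots> = (\<integral>x. w x * complex_of_real (F (?e x) - p (?e x)) \<partial>lebesgue)"
        using s d by (subst Bochner_Integration.integral_add) auto
      also have "norm \<dots> \<le> (\<integral>x. \<epsilon> * norm (w x) \<partial>lebesgue)"
      proof (intro Bochner_Integration.integral_norm_bound_integral d integrable_mult_right integrable_norm w)
        show "norm (w x * complex_of_real (F (?e x) - p (?e x))) \<le> \<epsilon> * norm (w x)" for x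
          using le[of x] \<open>\<epsilon> > 0\<close> by (simp only: real_norm_def abs_mult abs_norm_cancel abs_of_pos)
      qed
      finally show ?thesis by simp
    qed
    have "norm (\<integral>x. w x * complex_of_real (F (?e x)) \<partial>lebesgue) \<le> 0"
    proof (rule field_le_epsilon)
      fix \<epsilon> :: real assume "\<epsilon> > 0"
      define I where "I = (\<integral>x. norm (w x) \<partial>lebesgue)"
      have "I \<ge> 0" unfolding I_def by simp
      \<comment> \<open>Dividing by \<open>I + 1\<close> rather than \<open>I\<close> covers the
        case \<open>I = 0\<close>.\<close>
      then have "\<epsilon> / (I + 1) * I \<le> \<epsilon>" using \<open>\<epsilon> > 0\<close> by (simp add: field_simps)
      then show "norm (\<integral>x. w x * complex_of_real (F (?e x)) \<partial>lebesgue) \<le> 0 + \<epsilon>"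
        using *[of "\<epsilon> / (I + 1)"] \<open>\<epsilon> > 0\<close> \<open>I \<ge> 0\<close> unfolding I_def[symmetric] by simp
    qed
    then show ?thesis by simp
  qed
  have "(\<integral>x. w x * indicator S x \<partial>lebesgue) = 0" if S: "compact S" "S \<noteq> {}" for S
  proof -
    \<comment> \<open>Continuous cutoffs decreasing to the indicator of the compact image of
      \<open>S\<close>; by injectivity of the embedding they pull back to cutoffs of
      \<open>S\<close> itself. The empty set is treated apart, because \<open>infdist\<close> to it
      is \<open>0\<close> by convention and \<open>F n\<close> would be constantly
      \<open>1\<close>.\<close>
    define F where "F = (\<lambda>n::nat. \<lambda>y. max 0 (1 - real n * infdist y (?e ` S)))"
    have clos: "closed (?e ` S)" "?e ` S \<noteq> {}"
      using S continuous_on_gaussian_embedding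
      by (auto intro!: compact_imp_closed compact_continuous_image)
    have lim: "(\<lambda>n. F n (?e x)) \<longlonglongrightarrow> indicator S x" for x
    proof (cases "x \<in> S")
      case True
      then show ?thesis by (simp add: F_def)
    next
      case False
      then have "?e x \<notin> ?e ` S" using inj_gaussian_embedding by (auto dest: injD)
      then have pos: "infdist (?e x) (?e ` S) > 0"
        using clos infdist_pos_not_in_closed by blast
      have "eventually (\<lambda>n. real n > 1 / infdist (?e x) (?e ` S)) sequentially"
        using filterlim_real_sequentially unfolding filterlim_at_top_dense by blast
      then have "eventually (\<lambda>n. F n (?e x) = 0) sequentially"
        by eventually_elim (use pos in \<open>simp add: F_def field_simps\<close>)
      then show ?thesis using False by (simp add: tendsto_eventually)
    qed
    have contF: "continuous_on UNIV (F n)" for n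
      unfolding F_def by (intro continuous_intros)
    have [measurable]: "(\<lambda>x. F n (?e x)) \<in> borel_measurable lebesgue" for n
      using borel_measurable_continuous_onI[OF contF] by measurable
    have [measurable]: "S \<in> sets lebesgue" using S(1) by (simp add: lmeasurable_compact fmeasurableD)
    have "(\<lambda>n. \<integral>x. w x * complex_of_real (F n (?e x)) \<partial>lebesgue)
        \<longlonglongrightarrow> (\<integral>x. w x * complex_of_real (indicator S x) \<partial>lebesgue)"
    proof (rule integral_dominated_convergence[where w = "\<lambda>x. norm (w x)"])
      show "AE x in lebesgue. norm (w x * complex_of_real (F n (?e x))) \<le> norm (w x)" for n
        by (auto simp: norm_mult F_def infdist_nonneg intro!: mult_left_le)
      show "AE x in lebesgue. (\<lambda>n. w x * complex_of_real (F n (?e x)))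
          \<longlonglongrightarrow> w x * complex_of_real (indicator S x)"
        by (intro AE_I2 tendsto_intros lim)
      show "integrable lebesgue (\<lambda>x. norm (w x))" using w by (rule integrable_norm)
    qed measurable
    then show ?thesis using cont[OF contF] by (simp add: LIMSEQ_const_iff of_real_indicator)
  qed
  then have "(\<integral>x. w x * indicator S x \<partial>lebesgue) = 0" if "compact S" for S
    using that by (cases "S = {}") auto
  then have "AE x in lebesgue. w x = 0"
    by (rule AE_zero_if_compact_integrals_zero[OF w])
  then show ?thesis by eventually_elim (simp add: w_def)
qed

text \<open>Integrability against every Schwartz function is part of \<open>represents\<close>, so
  the difference of two representatives can be tested. This later identifies the arbitrary choice
  \<open>fourier_fun\<close> with an explicit transform.\<close>

lemma represents_unique:
  assumes "represents g u" "represents g' u"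
  shows "AE x in lebesgue. g x = g' x"
proof -
  have "AE x in lebesgue. g x - g' x = 0"
  proof (rule AE_zero_if_orthogonal_to_schwartz)
    fix \<phi> :: "'a \<Rightarrow> complex" assume "\<phi> \<in> schwartz"
    with assms have *: "integrable lebesgue (\<lambda>x. g x * \<phi> x)" "integrable lebesgue (\<lambda>x. g' x * \<phi> x)"
      "(\<integral>x. g x * \<phi> x \<partial>lebesgue) = (\<integral>x. g' x * \<phi> x \<partial>lebesgue)"
      unfolding represents_def dist_of_fun_def by metis+
    show "integrable lebesgue (\<lambda>x. (g x - g' x) * \<phi> x)"
      using * by (simp add: left_diff_distrib)
    show "(\<integral>x. (g x - g' x) * \<phi> x \<partial>lebesgue) = 0"
      using * by (simp add: left_diff_distrib)
  qed (use assms in \<open>auto simp: represents_def\<close>)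
  then show ?thesis by simp
qed

section \<open>Fourier transforms of Gaussians\<close>

text \<open>Lebesgue measure is the image of the product of its one-dimensional copies under the
  coordinate map, so Fubini applies factor by factor.\<close>

lemma lborel_integral_prod:
  fixes f :: "'a::euclidean_space \<Rightarrow> real \<Rightarrow> 'b::{real_normed_field, banach, second_countable_topology}"
  assumes "\<And>b. b \<in> Basis \<Longrightarrow> integrable lborel (f b)"
  shows "integrable lborel (\<lambda>x. \<Prod>b\<in>Basis. f b (x \<bullet> b))"
    and "(\<integral>x. (\<Prod>b\<in>Basis. f b (x \<bullet> b)) \<partial>lborel) = (\<Prod>b\<in>Basis. \<integral>x. f b x \<partial>lborel)"
proof -
  interpret product_sigma_finite "\<lambda>_::'a. lborel :: real measure"
    by standard
  have [measurable]: "f b \<in> borel_measurable borel" if "b \<in> Basis" for b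
    using assms[OF that] by auto
  have eq: "(\<Prod>b\<in>Basis. f b ((\<Sum>c\<in>Basis. y c *\<^sub>R c) \<bullet> b)) = (\<Prod>b\<in>Basis. f b (y b))" for y
    by (intro prod.cong refl) simp
  have m1: "(\<lambda>y. \<Sum>c\<in>Basis. y c *\<^sub>R c) \<in> measurable (\<Pi>\<^sub>M b\<in>Basis. lborel) (borel :: 'a measure)"
    by measurable
  have m2: "(\<lambda>x. \<Prod>b\<in>Basis. f b (x \<bullet> b)) \<in> borel_measurable borel"
    by measurable
  show "integrable lborel (\<lambda>x. \<Prod>b\<in>Basis. f b (x \<bullet> b))"
    unfolding lborel_eq[where 'a='a] integrable_distr_eq[OF m1 m2] eq
    by (rule product_integrable_prod) (use assms in auto)
  show "(\<integral>x. (\<Prod>b\<in>Basis. f b (x \<bullet> b)) \<partial>lborel) = (\<Prod>b\<in>Basis. \<integral>x. f b x \<partial>lborel)"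
    unfolding lborel_eq[where 'a='a] integral_distr[OF m1 m2] eq
    by (rule product_integral_prod) (use assms in auto)
qed

text \<open>Rescaling by \<open>1 / r\<close> turns the integrand into the standard normal density,
  up to \<open>sqrt (2 * pi)\<close>, times a character; the value is then the characteristic
  function of the normal distribution at \<open>- \<xi> / r\<close>.\<close>

lemma integral_gaussian_fourier_real:
  fixes r \<xi> :: real
  assumes "0 < r"
  shows "integrable lborel (\<lambda>x. exp (- (\<i> * of_real (x * \<xi>))) * complex_of_real (exp (- (r\<^sup>2 / 2) * x\<^sup>2)))"
    and "(\<integral>x. exp (- (\<i> * of_real (x * \<xi>))) * complex_of_real (exp (- (r\<^sup>2 / 2) * x\<^sup>2)) \<partial>lborel) =
      of_real (sqrt (2 * pi) * (exp (- (1 / (2 * r\<^sup>2)) * \<xi>\<^sup>2) / r))"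
proof -
  let ?f = "\<lambda>x. exp (- (\<i> * of_real (x * \<xi>))) * complex_of_real (exp (- (r\<^sup>2 / 2) * x\<^sup>2))"
  define g where "g = (\<lambda>x. std_normal_density x *\<^sub>R iexp (- \<xi> / r * x))"
  have bg: "integrable lborel g"
  proof (rule Bochner_Integration.integrable_bound)
    show "integrable lborel std_normal_density" by (rule integrable_normal_density) simp
  qed (auto simp: g_def)
  have ig: "(\<integral>x. g x \<partial>lborel) = of_real (exp (- ((\<xi> / r)\<^sup>2) / 2))"
  proof -
    have "(\<integral>x. g x \<partial>lborel) = char std_normal_distribution (- \<xi> / r)"
      unfolding char_def g_def
      by (subst integral_density) (auto simp: normal_density_nonneg)
    then show ?thesis by (simp add: char_std_normal_distribution)
  qed
  have eq: "?f (0 + 1 / r * x) = sqrt (2 * pi) * g x" for x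
    using assms
    by (simp add: g_def std_normal_density_def scaleR_conv_of_real power_mult_distrib power_divide
        field_simps)
  have "integrable lborel (\<lambda>x. ?f (0 + 1 / r * x))"
    unfolding eq using bg by simp
  then show "integrable lborel ?f"
    by (subst (asm) lborel_integrable_real_affine_iff) (use assms in auto)
  have "(\<integral>x. ?f x \<partial>lborel) = \<bar>1 / r\<bar> *\<^sub>R (\<integral>x. ?f (0 + 1 / r * x) \<partial>lborel)"
    by (rule lborel_integral_real_affine) (use assms in auto)
  then show "(\<integral>x. ?f x \<partial>lborel) = of_real (sqrt (2 * pi) * (exp (- (1 / (2 * r\<^sup>2)) * \<xi>\<^sup>2) / r))"
    unfolding eq using assms
    by (simp add: ig scaleR_conv_of_real power_divide field_simps)
qed

lemma integral_gaussian_fourier: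
  fixes \<xi> :: "'a::euclidean_space"
  assumes "0 < r"
  shows "integrable lborel (\<lambda>x. exp (- (\<i> * of_real (x \<bullet> \<xi>))) * complex_of_real (exp (- (r\<^sup>2 / 2) * (norm x)\<^sup>2)))"
      (is "integrable _ ?f")
    and "(\<integral>x. exp (- (\<i> * of_real (x \<bullet> \<xi>))) * complex_of_real (exp (- (r\<^sup>2 / 2) * (norm x)\<^sup>2)) \<partial>lborel) =
      of_real (sqrt (2 * pi) ^ DIM('a) * (exp (- (1 / (2 * r\<^sup>2)) * (norm \<xi>)\<^sup>2) / r ^ DIM('a)))"
proof -
  let ?g = "\<lambda>b::'a. \<lambda>x. exp (- (\<i> * of_real (x * (\<xi> \<bullet> b)))) * complex_of_real (exp (- (r\<^sup>2 / 2) * x\<^sup>2))"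
  have norm: "(norm x)\<^sup>2 = (\<Sum>b\<in>Basis. (x \<bullet> b)\<^sup>2)" for x :: 'a
    unfolding power2_norm_eq_inner euclidean_inner[of x x] by (simp add: power2_eq_square)
  have eq: "?f x = (\<Prod>b\<in>Basis. ?g b (x \<bullet> b))" for x
    unfolding norm euclidean_inner[of x \<xi>] prod.distrib of_real_sum sum_distrib_left
      exp_sum[OF finite_Basis] sum_negf[symmetric] of_real_prod
    by (simp add: exp_sum of_real_exp)
  show "integrable lborel ?f"
    unfolding eq by (intro lborel_integral_prod integral_gaussian_fourier_real assms)
  have "(\<integral>x. ?f x \<partial>lborel) = (\<Prod>b\<in>Basis. of_real (sqrt (2 * pi) * (exp (- (1 / (2 * r\<^sup>2)) * (\<xi> \<bullet> b)\<^sup>2) / r)))"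
    unfolding eq
    by (subst lborel_integral_prod) (intro integral_gaussian_fourier_real assms prod.cong refl)+
  also have "\<dots> = of_real (sqrt (2 * pi) ^ DIM('a) * (exp (- (1 / (2 * r\<^sup>2)) * (norm \<xi>)\<^sup>2) / r ^ DIM('a)))"
    unfolding norm of_real_prod[symmetric] prod.distrib prod_dividef sum_distrib_left exp_sum[OF finite_Basis]
    by simp
  finally show "(\<integral>x. ?f x \<partial>lborel) = \<dots>" .
qed

text \<open>This is the Fourier integral at frequency \<open>0\<close>, with \<open>r\<close> chosen
  so that \<open>r\<^sup>2 / 2 = a\<close>.\<close>

lemma integral_gaussian:
  fixes a :: real
  assumes "0 < a"
  shows "integrable lborel (\<lambda>x::'a::euclidean_space. exp (- a * (norm x)\<^sup>2))"
    and "(\<integral>x. exp (- a * (norm (x::'a))\<^sup>2) \<partial>lborel) = sqrt (pi / a) ^ DIM('a)"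
proof -
  define r where "r = sqrt (2 * a)"
  have r: "0 < r" "r\<^sup>2 / 2 = a" using assms by (auto simp: r_def)
  note * = integral_gaussian_fourier[OF r(1), of "0::'a", unfolded r(2)]
  have c: "integrable lborel (\<lambda>x::'a. complex_of_real (exp (- a * (norm x)\<^sup>2)))"
    using *(1) by simp
  then show i: "integrable lborel (\<lambda>x::'a. exp (- a * (norm x)\<^sup>2))"
    unfolding complex_of_real_integrable_eq .
  have "complex_of_real (\<integral>x. exp (- a * (norm (x::'a))\<^sup>2) \<partial>lborel) =
      of_real (sqrt (2 * pi) ^ DIM('a) / r ^ DIM('a))"
    using *(2) by (subst integral_complex_of_real[symmetric]) simp
  then have "(\<integral>x. exp (- a * (norm (x::'a))\<^sup>2) \<partial>lborel) = (sqrt (2 * pi) / r) ^ DIM('a)"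
    unfolding of_real_eq_iff by (simp add: power_divide)
  also have "sqrt (2 * pi) / r = sqrt (pi / a)"
    by (simp add: r_def real_sqrt_divide[symmetric])
  finally show "(\<integral>x. exp (- a * (norm (x::'a))\<^sup>2) \<partial>lborel) = sqrt (pi / a) ^ DIM('a)" .
qed

section \<open>The Gaussian data, their transforms and the multiplication formula\<close>

text \<open>The parameter is the frequency scale: the function has width \<open>1 / r\<close> in
  space and its transform has width \<open>r\<close>.\<close>

definition gaussian :: "real \<Rightarrow> 'a::euclidean_space \<Rightarrow> complex" where
  "gaussian r x = complex_of_real (exp (- (r\<^sup>2 / 2) * (norm x)\<^sup>2))"

lemma gaussian_in_schwartz: "0 < r \<Longrightarrow> gaussian r \<in> schwartz"
  using polynomial_gaussian_schwartz[OF real_polynomial_function.intros(2)[of 1], of "r\<^sup>2 / 2"]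
  by (simp add: gaussian_def[abs_def])

lemma fourier_gaussian:
  fixes \<xi> :: "'a::euclidean_space"
  assumes "0 < r"
  shows "fourier (gaussian r) \<xi> =
    of_real (exp (- (1 / (2 * r\<^sup>2)) * (norm \<xi>)\<^sup>2) / r ^ DIM('a))"
proof -
  have "(2 * pi) powr (- real DIM('a) / 2) * sqrt (2 * pi) ^ DIM('a) = 1"
    by (simp add: powr_half_sqrt[symmetric] powr_realpow[symmetric] powr_powr powr_add[symmetric])
  then have c: "complex_of_real ((2 * pi) powr (- real DIM('a) / 2)) * of_real (sqrt (2 * pi) ^ DIM('a) * y) =
     of_real y" for y
    unfolding of_real_mult[symmetric] mult.assoc[symmetric] by simp
  show ?thesis
    unfolding fourier_def gaussian_def
    by (subst integral_completion) (simp, simp only: integral_gaussian_fourier(2)[OF assms] c)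
qed

lemma inv_fourier_eq_fourier: "inv_fourier f x = fourier f (- x)"
  by (simp add: inv_fourier_def fourier_def inner_commute)

text \<open>Decay of order \<open>2 * DIM('a)\<close> beats the product of the factors
  \<open>1 + (x \<bullet> b)\<^sup>2\<close>, whose inverse is integrable coordinate by
  coordinate.\<close>

lemma schwartz_integrable:
  fixes f :: "'a::euclidean_space \<Rightarrow> complex"
  assumes "f \<in> schwartz"
  shows "integrable lborel f"
proof -
  obtain C where C: "\<And>x. (1 + norm x) ^ (2 * DIM('a)) * norm (f x) \<le> C"
    using schwartz_decay[OF assms] by metis
  have "integrable lborel (\<lambda>x::real. inverse (1 + x\<^sup>2))"
    using integrable_inverse_1_plus_square by (simp add: set_integrable_def)
  then have int: "integrable lborel (\<lambda>x::'a. \<Prod>b\<in>Basis. inverse (1 + (x \<bullet> b)\<^sup>2))"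
    by (intro lborel_integral_prod)
  have bound: "norm (f x) \<le> C * (\<Prod>b\<in>Basis. inverse (1 + (x \<bullet> b)\<^sup>2))" for x
  proof -
    have "(\<Prod>b\<in>Basis. 1 + (x \<bullet> b)\<^sup>2) \<le> (\<Prod>b\<in>(Basis::'a set). (1 + norm x)\<^sup>2)"
    proof (intro prod_mono conjI)
      fix b :: 'a assume "b \<in> Basis"
      then have "(x \<bullet> b)\<^sup>2 \<le> (norm x)\<^sup>2"
        using Basis_le_norm[of b x] by (simp add: abs_le_square_iff[symmetric])
      then show "1 + (x \<bullet> b)\<^sup>2 \<le> (1 + norm x)\<^sup>2"
        by (auto simp: power2_sum intro: add_increasing2)
    qed simp
    also have "\<dots> = (1 + norm x) ^ (2 * DIM('a))" by (simp add: power_mult)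
    finally have "(\<Prod>b\<in>Basis. 1 + (x \<bullet> b)\<^sup>2) * norm (f x) \<le> C"
      using C[of x] by (meson mult_right_mono norm_ge_zero order_trans)
    moreover have "0 < (\<Prod>b\<in>Basis. 1 + (x \<bullet> b)\<^sup>2)"
      by (intro prod_pos) (auto intro: add_pos_nonneg)
    ultimately show ?thesis
      unfolding prod_inversef[unfolded comp_def] by (simp add: field_simps)
  qed
  show ?thesis
    by (rule Bochner_Integration.integrable_bound[OF integrable_mult_right[OF int, of C]])
      (use schwartz_borel_measurable[OF assms] bound in \<open>auto intro: order_trans[OF bound abs_ge_self]\<close>)
qed

text \<open>The multiplication formula: Fubini for a kernel of modulus
  \<open>norm (g x) * norm (f y)\<close> that is symmetric in the two variables. It makes the
  distributional transform agree with the pointwise one.\<close>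

lemma integral_mult_fourier:
  fixes f g :: "'a::euclidean_space \<Rightarrow> complex"
  assumes f: "integrable lborel f" and g: "integrable lborel g"
  shows "(\<integral>x. g x * fourier f x \<partial>lebesgue) = (\<integral>x. fourier g x * f x \<partial>lebesgue)"
proof -
  define c where "c = complex_of_real ((2 * pi) powr (- real DIM('a) / 2))"
  have [measurable]: "f \<in> borel_measurable borel" "g \<in> borel_measurable borel"
    using f g by auto
  have F: "fourier h = (\<lambda>x. c * (\<integral>y. exp (- (\<i> * of_real (y \<bullet> x))) * h y \<partial>lborel))"
    if [measurable]: "h \<in> borel_measurable borel" for h :: "'a \<Rightarrow> complex"
    unfolding fourier_def c_def by (intro ext) (subst integral_completion; simp)
  have [measurable]: "fourier h \<in> borel_measurable borel"
    if [measurable]: "h \<in> borel_measurable borel" for h :: "'a \<Rightarrow> complex"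
    unfolding F[OF that] by measurable
  let ?k = "\<lambda>x y. exp (- (\<i> * of_real (y \<bullet> x))) * (g x * f y)"
  have int: "integrable (lborel \<Otimes>\<^sub>M lborel) (\<lambda>(x, y). ?k x y)"
  proof (rule lborel_pair.Fubini_integrable)
    show "integrable lborel (\<lambda>x. \<integral>y. norm ((case (x, y) of (x, y) \<Rightarrow> ?k x y)) \<partial>lborel)"
      using g by (simp add: norm_mult)
    show "AE x in lborel. integrable lborel (\<lambda>y. (case (x, y) of (x, y) \<Rightarrow> ?k x y))"
    proof (intro AE_I2)
      fix x
      show "integrable lborel (\<lambda>y. (case (x, y) of (x, y) \<Rightarrow> ?k x y))"
        by (rule Bochner_Integration.integrable_bound[OF integrable_mult_right[OF f, of "g x"]])
          (auto simp: norm_mult)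
    qed
  qed measurable
  have "(\<integral>x. g x * fourier f x \<partial>lebesgue) = c * (\<integral>x. \<integral>y. ?k x y \<partial>lborel \<partial>lborel)"
  proof -
    have "(\<integral>x. g x * fourier f x \<partial>lebesgue) = (\<integral>x. g x * fourier f x \<partial>lborel)"
      by (rule integral_completion) measurable
    also have "\<dots> = (\<integral>x. c * (\<integral>y. ?k x y \<partial>lborel) \<partial>lborel)"
      by (intro Bochner_Integration.integral_cong refl)
        (simp add: F integral_mult_right_zero[symmetric] mult_ac del: integral_mult_right_zero)
    finally show ?thesis by simp
  qed
  also have "(\<integral>x. \<integral>y. ?k x y \<partial>lborel \<partial>lborel) = (\<integral>y. \<integral>x. ?k x y \<partial>lborel \<partial>lborel)"
    using lborel_pair.Fubini_integral[OF int] by simp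
  also have "c * \<dots> = (\<integral>x. fourier g x * f x \<partial>lebesgue)"
  proof -
    have "(\<integral>x. fourier g x * f x \<partial>lebesgue) = (\<integral>x. fourier g x * f x \<partial>lborel)"
      by (rule integral_completion) measurable
    also have "\<dots> = (\<integral>y. c * (\<integral>x. ?k x y \<partial>lborel) \<partial>lborel)"
      by (intro Bochner_Integration.integral_cong refl)
        (simp add: F integral_mult_left_zero[symmetric] inner_commute mult_ac del: integral_mult_left_zero)
    finally show ?thesis by simp
  qed
  finally show ?thesis .
qed

section \<open>Sobolev norms of Gaussians\<close>

text \<open>For integrable \<open>g\<close> the seminorm of order \<open>0\<close>, which dominates
  the supremum norm, already controls the functional.\<close>

lemma tempered_distribution_dist_of_fun:
  fixes g :: "'a::euclidean_space \<Rightarrow> complex"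
  assumes g: "integrable lborel g"
  shows "tempered_distribution (dist_of_fun g)"
proof -
  have [measurable]: "g \<in> borel_measurable borel" using g by auto
  have bound: "norm (g x * f x) \<le> norm (schwartz_seminorm 0 f * norm (g x))" if "f \<in> schwartz" for f x
  proof -
    have "norm (g x * f x) \<le> norm (g x) * schwartz_seminorm 0 f"
      unfolding norm_mult by (intro mult_left_mono norm_le_schwartz_seminorm that) simp
    also have "\<dots> \<le> \<bar>schwartz_seminorm 0 f * norm (g x)\<bar>"
      by (metis abs_ge_self mult.commute)
    finally show ?thesis by simp
  qed
  have int: "integrable lborel (\<lambda>x. g x * f x)" if f: "f \<in> schwartz" for f
    by (rule Bochner_Integration.integrable_bound[OF integrable_mult_right[OF integrable_norm[OF g], of "schwartz_seminorm 0 f"]])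
      (use bound[OF f] schwartz_borel_measurable[OF f] in auto)
  have eq: "dist_of_fun g f = (\<integral>x. g x * f x \<partial>lborel)" if f: "f \<in> schwartz" for f
    unfolding dist_of_fun_def
    by (rule integral_completion) (use schwartz_borel_measurable[OF f] in measurable)
  have int': "integrable lebesgue (\<lambda>x. g x * f x)" if f: "f \<in> schwartz" for f
    using int[OF f] schwartz_borel_measurable[OF f] by (subst integrable_completion) auto
  have "norm (dist_of_fun g f) \<le> (\<integral>x. norm (g x) \<partial>lborel) * schwartz_seminorm 0 f"
    if f: "f \<in> schwartz" for f
  proof -
    have "norm (dist_of_fun g f) \<le> (\<integral>x. norm (g x) * schwartz_seminorm 0 f \<partial>lborel)"
      unfolding eq[OF f]
    proof (intro Bochner_Integration.integral_norm_bound_integral int f)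
      show "norm (g x * f x) \<le> norm (g x) * schwartz_seminorm 0 f" for x
        unfolding norm_mult by (intro mult_left_mono norm_le_schwartz_seminorm f) simp
    qed (use g in simp)
    then show ?thesis using g by simp
  qed
  then show ?thesis
    unfolding tempered_distribution_def dist_of_fun_def
    using int' by (simp add: distrib_left mult.left_commute[of _ "_::complex"]) blast
qed

lemma represents_fourier:
  fixes g :: "'a::euclidean_space \<Rightarrow> complex"
  assumes g: "integrable lborel g" and fg: "integrable lborel (fourier g)"
  shows "represents (fourier g) (dist_fourier (dist_of_fun g))"
  unfolding represents_def
proof (intro conjI ballI)
  have [measurable]: "fourier g \<in> borel_measurable borel" using fg by auto
  show "fourier g \<in> borel_measurable lebesgue" by (rule measurable_completion) simp
  fix \<phi> :: "'a \<Rightarrow> complex" assume s: "\<phi> \<in> schwartz"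
  then have [measurable]: "\<phi> \<in> borel_measurable borel" by (rule schwartz_borel_measurable)
  obtain C where C: "\<And>x. norm (\<phi> x) \<le> C" using schwartz_decay[OF s, of 0] by auto
  have "norm (fourier g x * \<phi> x) \<le> norm (fourier g x) * C" for x
    unfolding norm_mult by (intro mult_left_mono C) simp
  then have "integrable lborel (\<lambda>x. fourier g x * \<phi> x)"
    using fg by (intro Bochner_Integration.integrable_bound[OF integrable_mult_left[OF integrable_norm[OF fg], of C]])
      (auto intro!: AE_I2 order_trans[OF _ abs_ge_self])
  then show "integrable lebesgue (\<lambda>x. fourier g x * \<phi> x)"
    by (subst integrable_completion) auto
  show "dist_fourier (dist_of_fun g) \<phi> = dist_of_fun (fourier g) \<phi>"
    unfolding dist_fourier_def dist_of_fun_def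
    by (rule integral_mult_fourier[OF schwartz_integrable[OF s] g])
qed

lemma represents_fourier_gaussian:
  assumes "0 < r"
  shows "represents (fourier (gaussian r)) (dist_fourier (dist_of_fun (gaussian r :: 'a::euclidean_space \<Rightarrow> _)))"
proof (rule represents_fourier)
  show "integrable lborel (gaussian r :: 'a \<Rightarrow> _)"
    by (intro schwartz_integrable gaussian_in_schwartz assms)
  have "integrable lborel (\<lambda>\<xi>::'a. complex_of_real (exp (- (1 / (2 * r\<^sup>2)) * (norm \<xi>)\<^sup>2)) / of_real (r ^ DIM('a)))"
    by (intro integrable_divide_zero impI integrable_of_real integral_gaussian) (use assms in auto)
  then show "integrable lborel (fourier (gaussian r) :: 'a \<Rightarrow> _)"
    by (simp add: fourier_gaussian[OF assms, abs_def])
qed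

text \<open>Since \<open>fourier_fun\<close> is a Hilbert choice, it can be computed only almost
  everywhere, through uniqueness of representatives.\<close>

lemma represents_fourier_fun:
  assumes "represents g (dist_fourier u)"
  shows "represents (fourier_fun u) (dist_fourier u)" "AE x in lebesgue. fourier_fun u x = g x"
proof -
  show r: "represents (fourier_fun u) (dist_fourier u)"
    unfolding fourier_fun_def by (rule someI[of _ g]) (rule assms)
  show "AE x in lebesgue. fourier_fun u x = g x" by (rule represents_unique[OF r assms])
qed

section \<open>Scaling and growth of the Sobolev integral\<close>

lemma nn_integral_lborel_scale:
  fixes f :: "'a::euclidean_space \<Rightarrow> ennreal"
  assumes [measurable]: "f \<in> borel_measurable borel" and r: "0 < r"
  shows "(\<integral>\<^sup>+x. f x \<partial>lborel) = (\<integral>\<^sup>+x. ennreal (r ^ DIM('a)) * f (r *\<^sub>R x) \<partial>lborel)"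
  by (subst lborel_affine[of r "0::'a"]) (use r in \<open>simp_all add: nn_integral_density nn_integral_distr\<close>)

text \<open>This is \<open>r ^ DIM('a)\<close> times the squared Sobolev norm of the datum, for
  \<open>1 \<le> r\<close>. The type argument fixes the space of integration, which \<open>k\<close>
  and \<open>r\<close> do not reveal.\<close>

definition gaussian_sobolev_integral :: "'a::euclidean_space itself \<Rightarrow> real \<Rightarrow> real \<Rightarrow> real" where
  "gaussian_sobolev_integral _ k r =
     (\<integral>\<eta>. (1 + (r * norm (\<eta>::'a))\<^sup>2) powr k * exp (- (norm \<eta>)\<^sup>2) \<partial>lborel)"

text \<open>Half of the exponent absorbs the polynomial growth, and the other half remains as an
  integrable majorant.\<close>

lemma integrable_powr_gaussian:
  "integrable lborel (\<lambda>x::'a::euclidean_space. (1 + (norm x)\<^sup>2) powr k * exp (- (norm x)\<^sup>2))"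
proof -
  obtain N :: nat where N: "k \<le> real N" using real_arch_simple by blast
  obtain C where C: "\<And>x::'a. (1 + norm x) ^ (2 * N) * exp (- (1 / 2) * (norm x)\<^sup>2) \<le> C"
    using polynomial_gaussian_bounded[of "1 / 2" "2 * N"] by auto
  have "(1 + (norm x)\<^sup>2) powr k * exp (- (norm x)\<^sup>2) \<le> C * exp (- (1 / 2) * (norm x)\<^sup>2)" for x :: 'a
  proof -
    have "(1 + (norm x)\<^sup>2) powr k \<le> (1 + (norm x)\<^sup>2) powr real N"
      using N by (intro powr_mono) auto
    also have "\<dots> = (1 + (norm x)\<^sup>2) ^ N" by (rule powr_realpow) (simp add: add_pos_nonneg)
    also have "\<dots> \<le> ((1 + norm x)\<^sup>2) ^ N"
      by (intro power_mono) (auto simp: power2_sum)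
    also have "\<dots> = (1 + norm x) ^ (2 * N)" by (simp add: power_mult)
    finally have "(1 + (norm x)\<^sup>2) powr k * exp (- (norm x)\<^sup>2) \<le> (1 + norm x) ^ (2 * N) * exp (- (norm x)\<^sup>2)"
      by (intro mult_right_mono) auto
    also have "(1 + norm x) ^ (2 * N) * exp (- (norm x)\<^sup>2) =
        (1 + norm x) ^ (2 * N) * exp (- (1 / 2) * (norm x)\<^sup>2) * exp (- (1 / 2) * (norm x)\<^sup>2)"
      by (simp add: mult.assoc exp_add[symmetric])
    also have "\<dots> \<le> C * exp (- (1 / 2) * (norm x)\<^sup>2)"
      by (intro mult_right_mono C) auto
    finally show ?thesis .
  qed
  then show ?thesis
    by (intro Bochner_Integration.integrable_bound[OF integrable_mult_right[OF integral_gaussian(1)[of "1 / 2"], of C]])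
      (auto intro!: AE_I2 order_trans[OF _ abs_ge_self])
qed

text \<open>Provides a majorant uniform in \<open>r\<close> for dominated convergence. For
  \<open>k \<ge> 0\<close>, \<open>1 + (r * y)\<^sup>2 \<le> r\<^sup>2 * (1 + y\<^sup>2)\<close>
  leaves the factor \<open>r powr (2 * (k - s))\<close>, at most \<open>1\<close>; for
  \<open>k < 0\<close> both factors on the left are at most \<open>1\<close>.\<close>

lemma powr_scaled_le:
  fixes r k s y :: real
  assumes "1 \<le> r" "k \<le> s" "0 \<le> s"
  shows "r powr (- 2 * s) * (1 + (r * y)\<^sup>2) powr k \<le> (1 + y\<^sup>2) powr \<bar>k\<bar>"
proof (cases "0 \<le> k")
  case True
  have "1 \<le> r\<^sup>2" using assms by simp
  then have "1 + (r * y)\<^sup>2 \<le> r\<^sup>2 * (1 + y\<^sup>2)" by (simp add: power_mult_distrib distrib_left)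
  then have "(1 + (r * y)\<^sup>2) powr k \<le> (r\<^sup>2 * (1 + y\<^sup>2)) powr k"
    using True by (intro powr_mono2) auto
  also have "\<dots> = (r powr 2) powr k * (1 + y\<^sup>2) powr k"
    using assms by (simp add: powr_mult powr_numeral)
  also have "\<dots> = r powr (2 * k) * (1 + y\<^sup>2) powr k" by (simp add: powr_powr)
  finally have "r powr (- 2 * s) * (1 + (r * y)\<^sup>2) powr k \<le>
      r powr (- 2 * s) * (r powr (2 * k) * (1 + y\<^sup>2) powr k)"
    by (intro mult_left_mono) auto
  also have "\<dots> = r powr (2 * (k - s)) * (1 + y\<^sup>2) powr k"
    by (simp add: powr_add[symmetric] mult.assoc[symmetric] algebra_simps)
  also have "\<dots> \<le> 1 * (1 + y\<^sup>2) powr k"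
    using assms powr_mono[of "2 * (k - s)" 0 r] by (intro mult_right_mono) auto
  finally show ?thesis using True by simp
next
  case False
  have "r powr (- 2 * s) * (1 + (r * y)\<^sup>2) powr k \<le> 1 * 1"
    using assms False powr_mono[of "- 2 * s" 0 r] powr_mono[of k 0 "1 + (r * y)\<^sup>2"]
    by (intro mult_mono) (auto split: if_splits)
  also have "\<dots> \<le> (1 + y\<^sup>2) powr \<bar>k\<bar>"
    by (simp add: ge_one_powr_ge_zero)
  finally show ?thesis .
qed

lemma integrable_scaled_powr_gaussian:
  assumes "1 \<le> r"
  shows "integrable lborel (\<lambda>x::'a::euclidean_space. (1 + (r * norm x)\<^sup>2) powr k * exp (- (norm x)\<^sup>2))"
proof -
  \<comment> \<open>Any \<open>s\<close> allowed by \<open>powr_scaled_le\<close> would serve, as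
    the positive constant \<open>r powr (- 2 * s)\<close> is divided out at the end.\<close>
  define s where "s = \<bar>k\<bar>"
  have s: "k \<le> s" "0 \<le> s" by (auto simp: s_def)
  have "integrable lborel (\<lambda>x::'a. r powr (- 2 * s) * (1 + (r * norm x)\<^sup>2) powr k * exp (- (norm x)\<^sup>2))"
    by (rule Bochner_Integration.integrable_bound[OF integrable_powr_gaussian[of "\<bar>k\<bar>"]])
      (auto intro!: AE_I2 mult_right_mono powr_scaled_le[OF assms s, simplified])
  then show ?thesis using assms by (simp add: mult.assoc)
qed

text \<open>Writing \<open>r\<close> for \<open>real (Suc n)\<close> and \<open>y\<close> for
  \<open>norm x\<close>, the scaled weight equals
  \<open>r powr (2 * (k - s)) * (1 / r\<^sup>2 + y\<^sup>2) powr k\<close>, which vanishes in the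
  limit for \<open>y > 0\<close>. Using \<open>Suc n\<close> keeps the scale at least
  \<open>1\<close>, as the majorant requires.\<close>

lemma gaussian_sobolev_integral_tendsto:
  assumes "k < s" "0 \<le> s"
  shows "((\<lambda>n. real (Suc n) powr (- 2 * s) * gaussian_sobolev_integral TYPE('a::euclidean_space) k (real (Suc n)))
    \<longlongrightarrow> 0) sequentially"
proof -
  have lim: "((\<lambda>n. real (Suc n) powr (- 2 * s) * (1 + (real (Suc n) * y)\<^sup>2) powr k) \<longlonglongrightarrow> 0)"
    if y: "y > 0" for y :: real
  proof -
    have f: "filterlim (\<lambda>n. real (Suc n)) at_top sequentially" by real_asymp
    have "(\<lambda>n. real (Suc n) powr (2 * (k - s)) * (1 / (real (Suc n))\<^sup>2 + y\<^sup>2) powr k)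
        \<longlonglongrightarrow> 0 * (0 + y\<^sup>2) powr k"
    proof (intro tendsto_mult tendsto_powr tendsto_add tendsto_const)
      show "(\<lambda>n. real (Suc n) powr (2 * (k - s))) \<longlonglongrightarrow> 0"
        by (rule tendsto_neg_powr[OF _ f]) (use assms in simp)
      show "(\<lambda>n. 1 / (real (Suc n))\<^sup>2) \<longlonglongrightarrow> 0" by real_asymp
    qed (use y in auto)
    moreover have "real (Suc n) powr (2 * (k - s)) * (1 / (real (Suc n))\<^sup>2 + y\<^sup>2) powr k =
        real (Suc n) powr (- 2 * s) * (1 + (real (Suc n) * y)\<^sup>2) powr k" for n
    proof -
      define r where "r = real (Suc n)"
      have r: "r > 0" by (simp add: r_def)
      have "1 + (r * y)\<^sup>2 = r powr 2 * (1 / r\<^sup>2 + y\<^sup>2)"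
        using r by (simp add: powr_numeral field_simps)
      then have "(1 + (r * y)\<^sup>2) powr k = r powr (2 * k) * (1 / r\<^sup>2 + y\<^sup>2) powr k"
        using r by (simp only: powr_mult powr_powr)
      moreover have "r powr (2 * (k - s)) = r powr (- 2 * s) * r powr (2 * k)"
        by (simp add: powr_add[symmetric] algebra_simps)
      ultimately show ?thesis unfolding r_def[symmetric] by simp
    qed
    ultimately show ?thesis by simp
  qed
  let ?f = "\<lambda>n. \<lambda>x::'a. real (Suc n) powr (- 2 * s) * (1 + (real (Suc n) * norm x)\<^sup>2) powr k * exp (- (norm x)\<^sup>2)"
  have "(\<lambda>n. \<integral>x. ?f n x \<partial>lborel) \<longlonglongrightarrow> integral\<^sup>L lborel (\<lambda>x::'a. 0::real)"
  proof (rule integral_dominated_convergence[OF _ _ integrable_powr_gaussian[of "\<bar>k\<bar>"]])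
    \<comment> \<open>At the origin the integrand is \<open>real (Suc n) powr (- 2 * s)\<close>,
      which does not tend to \<open>0\<close> when \<open>s = 0\<close>; a single point is
      negligible.\<close>
    have "AE x in lborel. x \<noteq> (0::'a)" by (rule AE_lborel_singleton)
    then show "AE x in lborel. (\<lambda>n. ?f n x) \<longlonglongrightarrow> 0"
    proof eventually_elim
      case (elim x)
      then show ?case using tendsto_mult_left_zero[OF lim[of "norm x"]] by simp
    qed
    show "AE x in lborel. norm (?f n x) \<le> (1 + (norm x)\<^sup>2) powr \<bar>k\<bar> * exp (- (norm x)\<^sup>2)" for n
    proof (intro AE_I2)
      fix x :: 'a
      have "real (Suc n) powr (- 2 * s) * (1 + (real (Suc n) * norm x)\<^sup>2) powr k \<le> (1 + (norm x)\<^sup>2) powr \<bar>k\<bar>"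
        by (rule powr_scaled_le) (use assms in auto)
      from mult_right_mono[OF this, of "exp (- (norm x)\<^sup>2)"]
      show "norm (?f n x) \<le> (1 + (norm x)\<^sup>2) powr \<bar>k\<bar> * exp (- (norm x)\<^sup>2)"
        by (simp add: abs_mult del: of_nat_Suc)
    qed
  qed auto
  then show ?thesis
    unfolding gaussian_sobolev_integral_def by (simp add: mult.assoc)
qed

lemma enn_powr_ennreal: "0 \<le> x \<Longrightarrow> enn_powr (ennreal x) r = ennreal (x powr r)"
  by (simp add: enn_powr_def)

lemma enn_powr_mono: "a \<le> b \<Longrightarrow> 0 \<le> r \<Longrightarrow> enn_powr a r \<le> enn_powr b r"
  unfolding enn_powr_def
  by (auto intro!: ennreal_leI powr_mono2 enn2real_mono simp: less_top top_unique)

text \<open>Once \<open>fourier_fun\<close> is replaced by the explicit transform, the substitution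
  \<open>\<xi> = r * \<eta>\<close> gives the Jacobian \<open>r ^ DIM('a)\<close> against
  \<open>r ^ (2 * DIM('a))\<close> in the denominator of the squared transform.\<close>

lemma sobolev_norm_gaussian:
  assumes "1 \<le> r"
  shows "sobolev_norm k (dist_of_fun (gaussian r :: 'a::euclidean_space \<Rightarrow> _)) =
    ennreal (sqrt (gaussian_sobolev_integral TYPE('a) k r / r ^ DIM('a)))"
proof -
  have r: "0 < r" using assms by simp
  let ?u = "dist_of_fun (gaussian r :: 'a \<Rightarrow> _)"
  let ?J = "gaussian_sobolev_integral TYPE('a) k r"
  define h where "h = (\<lambda>\<xi>::'a. (1 + (norm \<xi>)\<^sup>2) powr k * exp (- (1 / r\<^sup>2) * (norm \<xi>)\<^sup>2) / r ^ (2 * DIM('a)))"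
  have [measurable]: "h \<in> borel_measurable borel" unfolding h_def by measurable
  have sq: "((1 + (norm \<xi>)\<^sup>2) powr (k / 2) * norm (fourier (gaussian r) \<xi>)) powr 2 = h \<xi>" for \<xi> :: 'a
  proof -
    have "((1 + (norm \<xi>)\<^sup>2) powr (k / 2))\<^sup>2 = (1 + (norm \<xi>)\<^sup>2) powr k"
      by (simp add: powr_power add_nonneg_eq_0_iff)
    moreover have "(exp (- (1 / (2 * r\<^sup>2)) * (norm \<xi>)\<^sup>2))\<^sup>2 = exp (- (1 / r\<^sup>2) * (norm \<xi>)\<^sup>2)"
      by (simp add: exp_double[symmetric] field_simps)
    ultimately show ?thesis
      using r unfolding fourier_gaussian[OF r] h_def
      by (subst powr_numeral)
        (simp_all add: norm_mult norm_divide power_mult_distrib power_divide power_even_eq norm_power del: of_real_exp)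
  qed
  have "AE \<xi> in lebesgue. enn_powr (ennreal ((1 + (norm \<xi>)\<^sup>2) powr (k / 2) * norm (fourier_fun ?u \<xi>))) 2 = ennreal (h \<xi>)"
    using represents_fourier_fun(2)[OF represents_fourier_gaussian[OF r]]
    by eventually_elim (simp add: enn_powr_ennreal sq)
  then have "(\<integral>\<^sup>+\<xi>. enn_powr (ennreal ((1 + (norm \<xi>)\<^sup>2) powr (k / 2) * norm (fourier_fun ?u \<xi>))) 2 \<partial>lebesgue) =
      (\<integral>\<^sup>+\<xi>. ennreal (h \<xi>) \<partial>lebesgue)"
    by (rule nn_integral_cong_AE)
  also have "\<dots> = (\<integral>\<^sup>+\<xi>. ennreal (h \<xi>) \<partial>lborel)" by (rule nn_integral_completion)
  also have "\<dots> = (\<integral>\<^sup>+\<xi>. ennreal (r ^ DIM('a)) * ennreal (h (r *\<^sub>R \<xi>)) \<partial>lborel)"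
    by (rule nn_integral_lborel_scale[OF _ r]) measurable
  also have "\<dots> = (\<integral>\<^sup>+\<xi>. ennreal ((1 + (r * norm (\<xi>::'a))\<^sup>2) powr k * exp (- (norm \<xi>)\<^sup>2) / r ^ DIM('a)) \<partial>lborel)"
    using r by (intro nn_integral_cong)
      (simp add: h_def ennreal_mult'[symmetric] power_mult_distrib mult_2 power_add)
  also have "\<dots> = ennreal (?J / r ^ DIM('a))"
    using integrable_scaled_powr_gaussian[OF assms, where 'a='a, of k] r
    unfolding gaussian_sobolev_integral_def
    by (subst nn_integral_eq_integral) auto
  finally have eq: "(\<integral>\<^sup>+\<xi>. enn_powr (ennreal ((1 + (norm \<xi>)\<^sup>2) powr (k / 2) * norm (fourier_fun ?u \<xi>))) 2 \<partial>lebesgue) =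
    ennreal (?J / r ^ DIM('a))" .
  have "0 \<le> ?J / r ^ DIM('a)"
    using r unfolding gaussian_sobolev_integral_def by (intro divide_nonneg_pos integral_nonneg) auto
  then show ?thesis
    unfolding sobolev_norm_def Lp_enorm_def using eq by (simp add: enn_powr_ennreal powr_half_sqrt)
qed

lemma gaussian_in_sobolev:
  assumes "1 \<le> r"
  shows "dist_of_fun (gaussian r :: 'a::euclidean_space \<Rightarrow> _) \<in> sobolev k"
proof -
  have r: "0 < r" using assms by simp
  show ?thesis
    unfolding sobolev_def
    using represents_fourier_gaussian[OF r, where 'a='a] sobolev_norm_gaussian[OF assms, where 'a='a]
      tempered_distribution_dist_of_fun[OF schwartz_integrable[OF gaussian_in_schwartz[OF r]], where 'a='a]
    by auto
qed

section \<open>Lower bounds for the flow\<close>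

text \<open>Splitting at height \<open>s\<close>: the part where \<open>norm (g x) \<le> s\<close>
  contributes at most \<open>A / 2\<close> to the pairing, so the rest contributes at least
  \<open>A / 2\<close>, and there
  \<open>norm (g x) \<le> s powr (1 - q) * norm (g x) powr q\<close>. For
  \<open>q = \<infinity>\<close>, an essential supremum below \<open>s\<close> would bound the whole
  pairing by \<open>A / 2\<close>.\<close>

lemma Lp_enorm_ge_by_testing:
  fixes g :: "'a::euclidean_space \<Rightarrow> complex" and \<phi> :: "'a \<Rightarrow> real"
  assumes g: "g \<in> borel_measurable lebesgue"
    and \<phi>: "integrable lebesgue \<phi>" "\<And>x. 0 \<le> \<phi> x" "\<And>x. \<phi> x \<le> 1"
    and g\<phi>: "integrable lebesgue (\<lambda>x. g x * complex_of_real (\<phi> x))"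
    and A: "0 < A" "A \<le> norm (\<integral>x. g x * complex_of_real (\<phi> x) \<partial>lebesgue)"
    and s: "0 < s" "s * (\<integral>x. \<phi> x \<partial>lebesgue) \<le> A / 2"
    and q: "1 \<le> q"
  shows "ennreal (if q = \<infinity> then s else (s powr (real_of_ereal q - 1) * (A / 2)) powr (1 / real_of_ereal q))
    \<le> Lp_enorm lebesgue q (\<lambda>x. ennreal (norm (g x)))"
proof -
  have int: "integrable lebesgue (\<lambda>x. norm (g x) * \<phi> x)"
    using integrable_norm[OF g\<phi>] \<phi>(2) by (simp add: norm_mult)
  have le: "A \<le> (\<integral>x. norm (g x) * \<phi> x \<partial>lebesgue)"
    using A(2) integral_norm_bound[of lebesgue "\<lambda>x. g x * complex_of_real (\<phi> x)"] \<phi>(2)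
    by (simp add: norm_mult)
  show ?thesis
  proof (cases "q = \<infinity>")
    case True
    show ?thesis
    proof (rule ccontr)
      assume "\<not> ?thesis"
      then have lt: "esssup lebesgue (\<lambda>x. ennreal (norm (g x))) < ennreal s"
        using True by (simp add: Lp_enorm_def not_le)
      have "AE x in lebesgue. ennreal (norm (g x)) \<le> esssup lebesgue (\<lambda>x. ennreal (norm (g x)))"
        by (rule esssup_AE)
      then have "AE x in lebesgue. norm (g x) * \<phi> x \<le> s * \<phi> x"
      proof eventually_elim
        case (elim x)
        then have "ennreal (norm (g x)) < ennreal s" using lt by (rule le_less_trans)
        then show ?case using \<phi>(2) s(1) by (intro mult_right_mono) (auto simp: ennreal_less_iff)
      qed
      then have "(\<integral>x. norm (g x) * \<phi> x \<partial>lebesgue) \<le> (\<integral>x. s * \<phi> x \<partial>lebesgue)"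
        by (intro integral_mono_AE int integrable_mult_right \<phi>(1))
      then show False using le s(2) A(1) by simp
    qed
  next
    case False
    define p where "p = real_of_ereal q"
    have p: "1 \<le> p" "q = ereal p"
      using q False by (cases q; simp add: p_def one_ereal_def)+
    have pw: "norm (g x) * \<phi> x \<le> s * \<phi> x + s powr (1 - p) * norm (g x) powr p" for x
    proof (cases "norm (g x) \<le> s")
      case True
      then have "norm (g x) * \<phi> x \<le> s * \<phi> x" using \<phi>(2) by (rule mult_right_mono)
      then show ?thesis by (simp add: add_increasing2)
    next
      case False
      then have gs: "s \<le> norm (g x)" "0 < norm (g x)" using s(1) by linarith+
      have "norm (g x) * \<phi> x \<le> norm (g x)" using \<phi>(3) by (simp add: mult_left_le)
      also have "\<dots> = norm (g x) powr (1 - p) * norm (g x) powr p"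
        using gs by (simp add: powr_add[symmetric])
      also have "\<dots> \<le> s powr (1 - p) * norm (g x) powr p"
        using gs s(1) p by (intro mult_right_mono powr_mono2') auto
      finally show ?thesis using \<phi>(2)[of x] s(1) by (simp add: add_increasing)
    qed
    let ?I = "\<integral>\<^sup>+x. ennreal (norm (g x) powr p) \<partial>lebesgue"
    have I: "ennreal (s powr (p - 1) * (A / 2)) \<le> ?I"
    proof (cases "?I = \<infinity>")
      case fin: False
      have "integrable lebesgue (\<lambda>x. norm (g x) powr p)"
        using g fin by (intro integrableI_nonneg) (auto simp: less_top)
      note ip = this
      have "A \<le> (\<integral>x. s * \<phi> x + s powr (1 - p) * norm (g x) powr p \<partial>lebesgue)"
        by (rule order_trans[OF le])
          (intro integral_mono int Bochner_Integration.integrable_add integrable_mult_right \<phi>(1) ip pw)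
      also have "\<dots> = s * (\<integral>x. \<phi> x \<partial>lebesgue) + s powr (1 - p) * (\<integral>x. norm (g x) powr p \<partial>lebesgue)"
        using \<phi>(1) ip by simp
      finally have "A / 2 \<le> s powr (1 - p) * (\<integral>x. norm (g x) powr p \<partial>lebesgue)" using s(2) by simp
      then have "s powr (p - 1) * (A / 2) \<le> s powr (p - 1) * (s powr (1 - p) * (\<integral>x. norm (g x) powr p \<partial>lebesgue))"
        by (rule mult_left_mono) simp
      also have "\<dots> = (\<integral>x. norm (g x) powr p \<partial>lebesgue)"
        using s(1) by (simp add: mult.assoc[symmetric] powr_add[symmetric])
      finally show ?thesis using ip by (subst nn_integral_eq_integral) (auto intro: ennreal_leI)
    qed simp
    have "ennreal ((s powr (p - 1) * (A / 2)) powr (1 / p)) = enn_powr (ennreal (s powr (p - 1) * (A / 2))) (1 / p)"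
      using A(1) by (simp add: enn_powr_ennreal)
    also have "\<dots> \<le> enn_powr ?I (1 / p)" by (rule enn_powr_mono[OF I]) (use p in simp)
    also have "\<dots> = Lp_enorm lebesgue q (\<lambda>x. ennreal (norm (g x)))"
      using p by (simp add: Lp_enorm_def enn_powr_ennreal)
    finally show ?thesis using False by (simp add: p_def)
  qed
qed

lemma integral_gaussian_lebesgue:
  fixes a :: real
  assumes "0 < a"
  shows "integrable lebesgue (\<lambda>x::'a::euclidean_space. exp (- a * (norm x)\<^sup>2))"
    and "(\<integral>x. exp (- a * (norm (x::'a))\<^sup>2) \<partial>lebesgue) = sqrt (pi / a) ^ DIM('a)"
  using integral_gaussian[OF assms, where 'a='a]
  by (simp_all add: integrable_completion integral_completion)

text \<open>
  As long as \<^term>\<open>\<bar>t * P \<xi>\<bar> \<le> 1\<close>, the phase has real part at least \<open>1/2\<close>: for a bounded symbol the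
  flow does not disperse a wave packet before a time that is independent of its frequency.
\<close>

lemma norm_propagator_gaussian_ge:
  fixes P :: "'a::euclidean_space \<Rightarrow> real"
  assumes P: "P \<in> borel_measurable lebesgue" "AE \<xi> in lebesgue. \<bar>t * P \<xi>\<bar> \<le> 1" and r: "0 < r"
  shows "sqrt pi ^ DIM('a) / r ^ DIM('a) / 2 \<le> norm (propagator P t (dist_of_fun (gaussian r)) (gaussian r))"
proof -
  let ?u = "dist_of_fun (gaussian r :: 'a \<Rightarrow> _)"
  define F where "F = (\<lambda>\<xi>::'a. exp (- (1 / (2 * r\<^sup>2)) * (norm \<xi>)\<^sup>2) / r ^ DIM('a))"
  have F: "fourier (gaussian r) \<xi> = of_real (F \<xi>)" "inv_fourier (gaussian r) \<xi> = of_real (F \<xi>)" for \<xi>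
    by (simp_all only: fourier_gaussian[OF r] inv_fourier_eq_fourier norm_minus_cancel F_def)
  have F2: "(F \<xi>)\<^sup>2 = exp (- (1 / r\<^sup>2) * (norm \<xi>)\<^sup>2) / r ^ (2 * DIM('a))" for \<xi>
    by (simp add: F_def power_divide exp_double[symmetric] power_mult[symmetric] mult.commute)
  have iF: "integrable lebesgue (\<lambda>\<xi>. (F \<xi>)\<^sup>2)"
    unfolding F2 using r by (intro integrable_divide_zero impI integral_gaussian_lebesgue) auto
  have vF: "(\<integral>\<xi>. (F \<xi>)\<^sup>2 \<partial>lebesgue) = sqrt pi ^ DIM('a) / r ^ DIM('a)"
    unfolding F2 using r
    by (subst integral_divide_zero, subst integral_gaussian_lebesgue)
      (auto simp: real_sqrt_mult power_mult_distrib mult_2 power_add)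
  have [measurable]: "F \<in> borel_measurable lebesgue"
    unfolding F_def by (rule measurable_completion) measurable
  have [measurable]: "P \<in> borel_measurable lebesgue" by fact
  note rep = represents_fourier_fun[OF represents_fourier_gaussian[OF r], where 'a='a]
  have [measurable]: "fourier_fun ?u \<in> borel_measurable lebesgue"
    using rep(1) by (simp add: represents_def)
  let ?e = "\<lambda>\<xi>. exp (\<i> * of_real (t * P \<xi>))"
  let ?f = "\<lambda>\<xi>. ?e \<xi> * of_real ((F \<xi>)\<^sup>2)"
  have i: "integrable lebesgue ?f"
    by (rule Bochner_Integration.integrable_bound[OF iF]) (auto simp: norm_mult norm_power)
  \<comment> \<open>Pairing the solution with its own datum puts the real, even function
    \<open>F\<close> on both sides, so the phase is integrated against the nonnegative weight
    \<open>F\<^sup>2\<close>.\<close>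
  have "propagator P t ?u (gaussian r) = (\<integral>\<xi>. ?e \<xi> * fourier_fun ?u \<xi> * of_real (F \<xi>) \<partial>lebesgue)"
    by (simp add: propagator_def fourier_multiplier_def dist_inv_fourier_def dist_of_fun_def F)
  also have "\<dots> = (\<integral>\<xi>. ?f \<xi> \<partial>lebesgue)"
  proof (rule integral_cong_AE)
    show "AE \<xi> in lebesgue. ?e \<xi> * fourier_fun ?u \<xi> * of_real (F \<xi>) = ?f \<xi>"
      using rep(2) by eventually_elim (simp add: F power2_eq_square)
  qed measurable
  finally have eq: "propagator P t ?u (gaussian r) = (\<integral>\<xi>. ?f \<xi> \<partial>lebesgue)" .
  have "(\<integral>\<xi>. (F \<xi>)\<^sup>2 / 2 \<partial>lebesgue) \<le> (\<integral>\<xi>. Re (?f \<xi>) \<partial>lebesgue)"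
  proof (rule integral_mono_AE)
    show "AE \<xi> in lebesgue. (F \<xi>)\<^sup>2 / 2 \<le> Re (?f \<xi>)"
      using P(2)
    proof eventually_elim
      case (elim \<xi>)
      \<comment> \<open>The phase is at most \<open>1\<close>, hence below \<open>pi / 3\<close>,
        where the cosine equals \<open>1 / 2\<close>.\<close>
      have "cos (pi / 3) \<le> cos \<bar>t * P \<xi>\<bar>"
        by (rule cos_monotone_0_pi_le) (use elim pi_gt3 in auto)
      then have "1 / 2 \<le> cos (t * P \<xi>)" by (simp add: cos_60)
      then have "(F \<xi>)\<^sup>2 * (1 / 2) \<le> (F \<xi>)\<^sup>2 * cos (t * P \<xi>)"
        by (intro mult_left_mono) auto
      then show ?case by (simp add: Re_exp mult.commute flip: of_real_power)
    qed
  qed (use iF integrable_Re[OF i] in simp_all)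
  also have "\<dots> = Re (\<integral>\<xi>. ?f \<xi> \<partial>lebesgue)" by (rule integral_Re[OF i])
  also have "\<dots> \<le> norm (\<integral>\<xi>. ?f \<xi> \<partial>lebesgue)" by (rule complex_Re_le_cmod)
  finally show ?thesis unfolding eq using vF by simp
qed

text \<open>The constant is fixed before \<open>P\<close>, \<open>t\<close> and \<open>r\<close>:
  testing against the datum works with a height \<open>s\<close> independent of \<open>r\<close>, so
  the scale enters only through the pairing, of order \<open>r powr (- d)\<close> with
  \<open>d\<close> the dimension, raised to the power \<open>1 / q\<close>.\<close>

lemma dist_Lq_norm_propagator_gaussian_ge:
  fixes q :: ereal
  assumes q: "1 \<le> q"
  obtains c where "0 < c" and
    "\<And>P t r. P \<in> borel_measurable lebesgue \<Longrightarrow> AE \<xi> in lebesgue. \<bar>t * P \<xi>\<bar> \<le> 1 \<Longrightarrow> 0 < r \<Longrightarrow>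
      ennreal (c * r powr (- real DIM('a) * real_of_ereal (1 / q)))
        \<le> dist_Lq_norm q (propagator P t (dist_of_fun (gaussian r :: 'a::euclidean_space \<Rightarrow> _)))"
proof -
  \<comment> \<open>Chosen so that \<open>s\<close> times the integral of the Gaussian is exactly
    \<open>A / 2\<close> for every \<open>r\<close>, with \<open>A\<close> the lower bound for the
    pairing.\<close>
  define s where "s = 1 / (4 * sqrt 2 ^ DIM('a))"
  have s: "0 < s" by (simp add: s_def)
  define p where "p = real_of_ereal q"
  have p: "1 \<le> p \<and> q = ereal p" if "q \<noteq> \<infinity>"
    using q that by (cases q; simp add: p_def one_ereal_def)
  define c where "c = (if q = \<infinity> then s else (s powr (p - 1) * (sqrt pi ^ DIM('a) / 4)) powr (1 / p))"
  have c: "0 < c" using s by (simp add: c_def)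
  show thesis
  proof (rule that[OF c])
    fix P :: "'a \<Rightarrow> real" and t r :: real
    assume P: "P \<in> borel_measurable lebesgue" "AE \<xi> in lebesgue. \<bar>t * P \<xi>\<bar> \<le> 1" and r: "0 < r"
    define A where "A = sqrt pi ^ DIM('a) / r ^ DIM('a) / 2"
    let ?\<phi> = "\<lambda>x::'a. exp (- (r\<^sup>2 / 2) * (norm x)\<^sup>2)"
    have A: "0 < A" using r by (simp add: A_def)
    have val: "ennreal (c * r powr (- real DIM('a) * real_of_ereal (1 / q))) =
        ennreal (if q = \<infinity> then s else (s powr (p - 1) * (A / 2)) powr (1 / p))"
    proof (cases "q = \<infinity>")
      case False
      have eq: "s powr (p - 1) * (A / 2) = (s powr (p - 1) * (sqrt pi ^ DIM('a) / 4)) * r powr (- real DIM('a))"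
        using r by (simp add: A_def powr_minus powr_realpow field_simps)
      have "real_of_ereal (1 / q) = 1 / p" using p[OF False] by (simp add: one_ereal_def)
      then show ?thesis unfolding eq using False
        by (simp only: c_def if_False powr_mult[of _ "r powr _"] powr_powr)
    qed (use r in \<open>simp add: c_def\<close>)
    show "ennreal (c * r powr (- real DIM('a) * real_of_ereal (1 / q)))
        \<le> dist_Lq_norm q (propagator P t (dist_of_fun (gaussian r :: 'a \<Rightarrow> _)))"
      unfolding dist_Lq_norm_def
    \<comment> \<open>If no function represents the solution at time \<open>t\<close>, the infimum
      is \<open>top\<close> and the bound holds trivially.\<close>
    proof (rule INF_greatest)
      fix g assume "g \<in> {g. represents g (propagator P t (dist_of_fun (gaussian r :: 'a \<Rightarrow> _)))}"
      then have g: "represents g (propagator P t (dist_of_fun (gaussian r)))" by simp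
      have g': "g \<in> borel_measurable lebesgue" "integrable lebesgue (\<lambda>x. g x * complex_of_real (?\<phi> x))"
        "propagator P t (dist_of_fun (gaussian r)) (gaussian r) = (\<integral>x. g x * complex_of_real (?\<phi> x) \<partial>lebesgue)"
        using g gaussian_in_schwartz[OF r, where 'a='a]
        unfolding represents_def dist_of_fun_def[of g] gaussian_def[symmetric] by auto
      have "s * (\<integral>x. ?\<phi> x \<partial>lebesgue) \<le> A / 2"
        using r by (subst integral_gaussian_lebesgue)
          (auto simp: s_def A_def real_sqrt_mult real_sqrt_divide power_mult_distrib power_divide)
      moreover have "A \<le> norm (\<integral>x. g x * complex_of_real (?\<phi> x) \<partial>lebesgue)"
        using norm_propagator_gaussian_ge[OF P r] unfolding g'(3) A_def .
      ultimately show "ennreal (c * r powr (- real DIM('a) * real_of_ereal (1 / q)))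
          \<le> Lp_enorm lebesgue q (\<lambda>x. ennreal (norm (g x)))"
        unfolding val p_def using r
        by (intro Lp_enorm_ge_by_testing[where \<phi> = ?\<phi>] g' A s q integral_gaussian_lebesgue) auto
    qed
  qed
qed

section \<open>From fixed times to the norm in time\<close>

text \<open>A nondegenerate interval through \<open>0\<close> meets every neighbourhood of
  \<open>0\<close> in positive measure \<open>m\<close>, which yields the factor
  \<open>m powr (1 / p)\<close>. The function \<open>f\<close> is arbitrary because the integral
  bound rests on monotonicity alone.\<close>

lemma Lp_enorm_interval_ge:
  fixes I :: "real set" and p :: ereal
  assumes I: "is_interval I" "0 \<in> I" "0 < emeasure lebesgue I" and \<delta>: "0 < \<delta>" and p: "1 \<le> p"
  obtains c where "0 < c" and
    "\<And>f b. 0 \<le> b \<Longrightarrow> (\<And>t. t \<in> I \<Longrightarrow> \<bar>t\<bar> \<le> \<delta> \<Longrightarrow> ennreal b \<le> f t) \<Longrightarrow>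
      ennreal (c * b) \<le> Lp_enorm (lebesgue_on I) p f"
proof -
  have "I \<noteq> {0}" using I(3) by auto
  then obtain a where a: "a \<in> I" "a \<noteq> 0" using I(2) by blast
  \<comment> \<open>The truncation also makes the measure finite when \<open>I\<close> is
    unbounded.\<close>
  define J where "J = I \<inter> {-\<delta>..\<delta>}"
  have Iborel: "I \<in> sets borel"
    by (rule real_interval_borel_measurable[OF I(1)])
  then have Is: "I \<in> sets lebesgue" by simp
  have Js: "J \<in> sets (lebesgue_on I)" "J \<in> sets lebesgue"
    using Iborel by (auto simp: J_def sets_restrict_space)
  \<comment> \<open>The segment joining \<open>0\<close> to \<open>a\<close>, cut at distance
    \<open>\<delta>\<close>, whichever sign \<open>a\<close> has.\<close>
  define l u where "l = max (min a 0) (- \<delta>)" and "u = min (max a 0) \<delta>"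
  have lu: "l < u" using a(2) \<delta> by (auto simp: l_def u_def max_def min_def)
  have "{l..u} \<subseteq> J"
  proof
    fix x assume x: "x \<in> {l..u}"
    then have "x \<in> I"
      using I(1,2) a(1) mem_is_interval_1_I[OF I(1,2) a(1), of x] mem_is_interval_1_I[OF I(1) a(1) I(2), of x]
      by (auto simp: l_def u_def max_def min_def split: if_splits)
    then show "x \<in> J" using x by (auto simp: J_def l_def u_def)
  qed
  have "emeasure (lebesgue_on I) J = emeasure lebesgue J"
    using Is by (intro emeasure_restrict_space) (auto simp: J_def)
  have "emeasure lebesgue {l..u} \<le> emeasure lebesgue J"
    by (rule emeasure_mono) (use \<open>{l..u} \<subseteq> J\<close> Js in auto)
  then have pos: "0 < emeasure lebesgue J" using lu by (simp add: order.strict_trans2[rotated])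
  have "emeasure lebesgue J \<le> emeasure lebesgue {-\<delta>..\<delta>}"
    by (rule emeasure_mono) (auto simp: J_def)
  then have fin: "emeasure lebesgue J < \<infinity>" using \<delta> by (simp add: order.strict_trans1)
  define m where "m = measure lebesgue J"
  have em: "emeasure lebesgue J = ennreal m"
    unfolding m_def by (rule emeasure_eq_ennreal_measure) (use fin in auto)
  have m: "emeasure (lebesgue_on I) J = ennreal m" "0 < m"
    using pos \<open>emeasure (lebesgue_on I) J = emeasure lebesgue J\<close> unfolding em by simp_all
  define c where "c = (if p = \<infinity> then 1 else m powr (1 / real_of_ereal p))"
  show thesis
  proof (rule that)
    show "0 < c" using m by (simp add: c_def)
    fix f :: "real \<Rightarrow> ennreal" and b :: real
    assume b: "0 \<le> b" and f: "\<And>t. t \<in> I \<Longrightarrow> \<bar>t\<bar> \<le> \<delta> \<Longrightarrow> ennreal b \<le> f t"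
    have fJ: "ennreal b \<le> f t" if "t \<in> J" for t using f[of t] that by (auto simp: J_def)
    show "ennreal (c * b) \<le> Lp_enorm (lebesgue_on I) p f"
    proof (cases "p = \<infinity>")
      case True
      show ?thesis
      proof (rule ccontr)
        assume "\<not> ?thesis"
        then have lt: "esssup (lebesgue_on I) f < ennreal b" using True by (simp add: Lp_enorm_def c_def)
        have "AE t in lebesgue_on I. f t \<le> esssup (lebesgue_on I) f" by (rule esssup_AE)
        then have "AE t in lebesgue_on I. t \<notin> J"
          by eventually_elim (use fJ lt in \<open>meson leD le_less_trans\<close>)
        then have "J \<in> null_sets (lebesgue_on I)" using AE_iff_null_sets[OF Js(1)] by blast
        then show False using m by (simp add: null_sets_def)
      qed
    next
      case False
      define p' where "p' = real_of_ereal p"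
      have p': "1 \<le> p'" using p False by (cases p; simp add: p'_def one_ereal_def)
      have "ennreal (b powr p' * m) = (\<integral>\<^sup>+t. ennreal (b powr p') * indicator J t \<partial>lebesgue_on I)"
        using Js(1) m by (subst nn_integral_cmult_indicator) (auto simp: ennreal_mult)
      also have "\<dots> \<le> (\<integral>\<^sup>+t. enn_powr (f t) p' \<partial>lebesgue_on I)"
      proof (rule nn_integral_mono)
        fix t
        have "ennreal (b powr p') \<le> enn_powr (f t) p'" if "t \<in> J"
          using enn_powr_mono[OF fJ[OF that], of p'] p' b by (simp add: enn_powr_ennreal)
        then show "ennreal (b powr p') * indicator J t \<le> enn_powr (f t) p'"
          by (auto simp: indicator_def)
      qed
      finally have "enn_powr (ennreal (b powr p' * m)) (1 / p') \<le> Lp_enorm (lebesgue_on I) p f"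
        unfolding Lp_enorm_def using False p' by (simp add: p'_def[symmetric] enn_powr_mono)
      moreover have "(b powr p' * m) powr (1 / p') = c * b"
        using False p' m b by (simp add: c_def p'_def[symmetric] powr_mult powr_powr)
      ultimately show ?thesis using m by (simp add: enn_powr_ennreal)
    qed
  qed
qed

section \<open>Real constants from the hypotheses, and the contradiction\<close>

lemma AE_bounded_if_Lp_enorm_infinity:
  assumes "Lp_enorm M \<infinity> (\<lambda>x. ennreal \<bar>f x\<bar>) < \<infinity>"
  obtains B where "0 < B" "AE x in M. \<bar>f x\<bar> \<le> B"
proof -
  define b where "b = enn2real (esssup M (\<lambda>x. ennreal \<bar>f x\<bar>))"
  have b: "esssup M (\<lambda>x. ennreal \<bar>f x\<bar>) = ennreal b"
    using assms by (simp add: b_def Lp_enorm_def less_top)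
  have "0 \<le> b" by (simp add: b_def)
  have "AE x in M. ennreal \<bar>f x\<bar> \<le> esssup M (\<lambda>x. ennreal \<bar>f x\<bar>)" by (rule esssup_AE)
  \<comment> \<open>Adding \<open>1\<close> keeps the bound positive when \<open>f\<close> vanishes
    almost everywhere, so that a time scale \<open>1 / B\<close> can be formed.\<close>
  then have "AE x in M. \<bar>f x\<bar> \<le> b + 1"
    unfolding b by eventually_elim (use \<open>0 \<le> b\<close> in \<open>simp add: ennreal_le_iff\<close>)
  then show thesis using \<open>0 \<le> b\<close> by (intro that[of "b + 1"]) auto
qed

text \<open>Both \<open>1 / q\<close> and \<open>2 / p\<close> are finite even at infinite
  exponents, so the scaling relation can be carried out with the reals \<open>\<kappa>\<close> and
  \<open>\<sigma>\<close>.\<close>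

lemma admissibleE:
  assumes "admissible d p q"
  obtains \<kappa> \<sigma> where "1 / q = ereal \<kappa>" "2 / p = ereal \<sigma>" "\<sigma> = real d / 2 - real d * \<kappa>" "0 \<le> \<sigma>"
    "2 / p = ereal (real d) / 2 - ereal (real d) / q"
proof -
  have pq: "2 \<le> p" "2 \<le> q" "2 / p = ereal (real d) * (1 / 2 - 1 / q)"
    using assms by (auto simp: admissible_def)
  have two: "2 = ereal 2" "1 = ereal 1" by (simp_all add: one_ereal_def)
  define \<kappa> where "\<kappa> = real_of_ereal (1 / q)"
  have \<kappa>: "1 / q = ereal \<kappa>" "ereal (real d) / q = ereal (real d * \<kappa>)"
    using pq(2) by (cases q; simp add: \<kappa>_def two)+
  have 1: "2 / p = ereal (real d / 2 - real d * \<kappa>)"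
    unfolding pq(3) \<kappa>(1) by (simp add: two algebra_simps)
  have "0 \<le> 2 / p" using pq(1) by (cases p) (auto simp: two)
  then have "0 \<le> real d / 2 - real d * \<kappa>" unfolding 1 by simp
  moreover have "2 / p = ereal (real d) / 2 - ereal (real d) / q"
    unfolding 1 \<kappa>(2) by (simp add: two)
  ultimately show thesis using that \<kappa>(1) 1 by blast
qed

theorem corollary1p3:
  fixes P :: "'a::euclidean_space \<Rightarrow> real"
    and p q :: ereal and k C :: real and I :: "real set"
  assumes P_measurable: "P \<in> borel_measurable lebesgue"
    and P_bounded: "Lp_enorm lebesgue \<infinity> (\<lambda>\<xi>. ennreal \<bar>P \<xi>\<bar>) < \<infinity>"
    and adm: "admissible DIM('a) p q"
    and I_interval: "is_interval I" "0 \<in> I" "0 < emeasure lebesgue I"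
    and C_pos: "0 < C"
    and estimate: "\<And>u\<^sub>0. u\<^sub>0 \<in> sobolev k \<Longrightarrow>
      Lp_enorm (lebesgue_on I) p (\<lambda>t. dist_Lq_norm q (propagator P t u\<^sub>0))
        \<le> ennreal C * sobolev_norm k u\<^sub>0"
  shows "2 / p \<le> ereal k \<and>
    2 / p = ereal (real DIM('a)) / 2 - ereal (real DIM('a)) / q"
proof -
  let ?d = "real DIM('a)" and ?J = "gaussian_sobolev_integral TYPE('a) k"
  obtain \<kappa> \<sigma> where \<kappa>: "1 / q = ereal \<kappa>" and \<sigma>: "2 / p = ereal \<sigma>" "\<sigma> = ?d / 2 - ?d * \<kappa>" "0 \<le> \<sigma>"
    and scaling: "2 / p = ereal ?d / 2 - ereal ?d / q"
    using admissibleE[OF adm] by metis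
  have "2 \<le> p" "2 \<le> q" using adm by (simp_all only: admissible_def)
  then have pq: "1 \<le> p" "1 \<le> q" by (auto intro: order_trans[of 1 2])
  obtain B where B: "0 < B" "AE \<xi> in lebesgue. \<bar>P \<xi>\<bar> \<le> B"
    using AE_bounded_if_Lp_enorm_infinity[OF P_bounded] by metis
  obtain c where c: "0 < c" and
    Lq: "\<And>t r. AE \<xi> in lebesgue. \<bar>t * P \<xi>\<bar> \<le> 1 \<Longrightarrow> 0 < r \<Longrightarrow>
      ennreal (c * r powr (- ?d * \<kappa>)) \<le> dist_Lq_norm q (propagator P t (dist_of_fun (gaussian r)))"
    using dist_Lq_norm_propagator_gaussian_ge[OF pq(2), where 'a='a] P_measurable \<kappa>
    by (metis real_of_ereal.simps(1))
  obtain c' where c': "0 < c'" and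
    Lp: "\<And>f b. 0 \<le> b \<Longrightarrow> (\<And>t. t \<in> I \<Longrightarrow> \<bar>t\<bar> \<le> 1 / B \<Longrightarrow> ennreal b \<le> f t) \<Longrightarrow>
      ennreal (c' * b) \<le> Lp_enorm (lebesgue_on I) p f"
    using Lp_enorm_interval_ge[OF I_interval _ pq(1), of "1 / B"] B(1) by (metis zero_less_divide_1_iff)
  have phase: "AE \<xi> in lebesgue. \<bar>t * P \<xi>\<bar> \<le> 1" if "\<bar>t\<bar> \<le> 1 / B" for t
    using B(2)
  proof eventually_elim
    case (elim \<xi>)
    have "\<bar>t\<bar> * \<bar>P \<xi>\<bar> \<le> 1 / B * B" using that elim B(1) by (intro mult_mono) auto
    then show ?case using B(1) by (simp add: abs_mult)
  qed
  \<comment> \<open>The assumed estimate at Gaussian data, squared and multiplied by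
    \<open>r powr (2 * ?d * \<kappa>)\<close>. The powers of \<open>r\<close> combine because
    \<open>- ?d + 2 * ?d * \<kappa> = - 2 * \<sigma>\<close>.\<close>
  have key: "(c' * c / C)\<^sup>2 \<le> r powr (- 2 * \<sigma>) * ?J r" if r: "1 \<le> r" for r
  proof -
    have r0: "0 < r" using r by simp
    have J0: "0 \<le> ?J r" unfolding gaussian_sobolev_integral_def by simp
    have "ennreal (c' * (c * r powr (- ?d * \<kappa>)))
        \<le> Lp_enorm (lebesgue_on I) p (\<lambda>t. dist_Lq_norm q (propagator P t (dist_of_fun (gaussian r))))"
      using c by (intro Lp Lq phase r0) auto
    also have "\<dots> \<le> ennreal C * ennreal (sqrt (?J r / r ^ DIM('a)))"
      using estimate[OF gaussian_in_sobolev[OF r]] by (simp add: sobolev_norm_gaussian[OF r])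
    also have "\<dots> = ennreal (C * sqrt (?J r / r ^ DIM('a)))"
      using C_pos J0 r0 by (simp add: ennreal_mult)
    finally have "c' * (c * r powr (- ?d * \<kappa>)) \<le> C * sqrt (?J r / r ^ DIM('a))"
      using C_pos J0 r0 by (subst (asm) ennreal_le_iff) auto
    then have "(c' * c / C) * r powr (- ?d * \<kappa>) \<le> sqrt (?J r / r ^ DIM('a))"
      using C_pos by (simp add: field_simps)
    then have "((c' * c / C) * r powr (- ?d * \<kappa>))\<^sup>2 \<le> (sqrt (?J r / r ^ DIM('a)))\<^sup>2"
      using c c' C_pos by (intro power_mono) auto
    also have "\<dots> = ?J r * r powr (- ?d)"
      using J0 r0 by (simp add: powr_minus powr_realpow field_simps)
    finally have "(c' * c / C)\<^sup>2 * r powr (- 2 * ?d * \<kappa>) \<le> ?J r * r powr (- ?d)"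
      unfolding power_mult_distrib by (simp add: power2_eq_square[of "r powr _"] powr_add[symmetric] mult_ac)
    then have "(c' * c / C)\<^sup>2 * r powr (- 2 * ?d * \<kappa>) * r powr (2 * ?d * \<kappa>)
        \<le> ?J r * r powr (- ?d) * r powr (2 * ?d * \<kappa>)"
      by (rule mult_right_mono) simp
    also have "\<dots> = r powr (- 2 * \<sigma>) * ?J r"
      unfolding \<sigma>(2) by (simp add: powr_add[symmetric] mult.assoc algebra_simps)
    finally show ?thesis
      using r0 by (simp add: powr_add[symmetric] mult.assoc)
  qed
  have "\<sigma> \<le> k"
  proof (rule ccontr)
    assume "\<not> \<sigma> \<le> k"
    \<comment> \<open>With \<open>k < \<sigma>\<close> the right side of \<open>key\<close> tends to
      \<open>0\<close>, while its left side is a fixed positive number.\<close>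
    then have "(\<lambda>n. real (Suc n) powr (- 2 * \<sigma>) * ?J (real (Suc n))) \<longlonglongrightarrow> 0"
      by (intro gaussian_sobolev_integral_tendsto \<sigma>) simp
    then have "(c' * c / C)\<^sup>2 \<le> 0"
      by (rule LIMSEQ_le_const) (intro exI[of _ 0] allI impI key, simp)
    then show False using c c' C_pos by simp
  qed
  then have "2 / p \<le> ereal k" unfolding \<sigma>(1) by simp
  with scaling show ?thesis by blast
qed

end
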